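(* Let $k,m\ge1$ and $r\ge2$ be integers, $q=2r-1>1$, $R=\mathbb Q[x,y]$, and let $I=E_2(L)\cap R=\langle A_q(x),G_k(x,y),H_m(x,y)\rangle$ for the oriented ordered two-component pretzel link $L=P(2k,2r-1,2m)$ (with $y=t_1$, $x=t_2$). With $\mathcal D$, $\Pi_0$, $h$ as defined in the context, assume $g=\gcd(m,k)=1$. Then $$\mathcal D=\{\delta>1:\ \delta\mid q,\ \delta\mid mk,\ \delta\nmid m,\ \delta\nmid k\}.$$ If $\mathcal D=\varnothing$, then $\mathrm{AG}_2(L)=\{1\}$. Otherwise, $$I=\langle\Pi_0(x),\,y-h(x)\rangle,\qquad \mathrm{AG}_2(L)=\{y-h(x),\,\Pi_0(x)\}.$$
   Context: $A_q(x)=\frac{1+x^q}{1+x}$, $G_k(x,y)=\frac{1-(xy)^k}{1-xy}$, $H_m(x,y)=\frac{x^m-y^m}{x-y}$ (polynomials). $\Phi_n(x)$ is the $n$th cyclotomic polynomial. For $\delta\mid q$, $\delta>1$: $\mathcal K_\delta=\mathbb Q[x]/(\Phi_{2\delta}(x))$, $x_\delta$ is the class of $x$, $p_\delta(y)\in\mathcal K_\delta[y]$ is the monic gcd of $G_k(x_\delta,y)$ and $H_m(x_\delta,y)$, and $d_\delta=\deg_y p_\delta$. Put $\mathcal D=\{\delta>1:\delta\mid q,\ d_\delta>0\}$ and, when $\mathcal D\ne\varnothing$, $\Pi_0(x)=\prod_{\delta\in\mathcal D}\Phi_{2\delta}(x)$. Choose $u,v\in\mathbb Z$ with $um+vk=g$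 (here $g=1$) and put $e=um-vk$. Since $\Pi_0(0)=1$, $x$ is invertible modulo $\Pi_0$; $h(x)\in\mathbb Q[x]$ is the unique polynomial with $\deg h<\deg\Pi_0$ and $h\equiv x^e\pmod{\Pi_0}$ (negative powers interpreted in $\mathbb Q[x]/(\Pi_0)$; independent of the choice of $u,v$). $\mathrm{AG}_2(L)$ is the reduced Gröbner basis, for the lexicographic order $y>x$, of $E_2(L)\cap R$ (it is $\{1\}$ for the unit ideal), where $E_2(L)\subset\mathbb Q[x^{\pm1},y^{\pm1}]$ is the second elementary ideal of the link group with $\phi$ sending the positive meridian of the $i$th component to the $i$th standard basis vector of $\mathbb Z^2$: for a presentation with $n$ generators it is generated by the $(n-2)\times(n-2)$ minors of the Fox matrix evaluated under $\phi$. For $L=P(2k,2r-1,2m)$ the link group is $\langle a,b,c\mid r_1,r_2\rangle$, $r_1=(cb)^r b^{-1}(cb)^{-r}(ac^{-1})^m c(ca^{-1})^m$, $r_2=(ab)^{-k}b(ab)^k(cb)^{r-1}c^{-1}(cb)^{-(r-1)}$, with $a\mapsto y$, $b,c\mapsto x$; one has $I=E_2(L)\cap R=\langle A_q,G_k,H_m\rangle$. *)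

theory Defs
  imports
    "HOL-Computational_Algebra.Computational_Algebra"
    "HOL-Library.Poly_Mapping"
    "HOL-Library.Product_Plus"
    "HOL-Number_Theory.Cong"
    "Jordan_Normal_Form.Determinant"
    "Jordan_Normal_Form.DL_Submatrix"
begin

definition ideal_gen :: "'a::comm_ring_1 set \<Rightarrow> 'a set" where
  "ideal_gen S = Modules.module.span (*) S"


section \<open>Laurent polynomials and elementary ideals\<close>

text \<open>
  The exponent vector \<open>(i, j)\<close> stands for the monomial $t_1^i t_2^j = y^i x^j$, and the
  Laurent ring $\mathbb{Q}[x^{\pm 1}, y^{\pm 1}]$ is the group ring of $\mathbb{Z}^2$ over the rationals.
\<close>

type_synonym laurent = "(int \<times> int) \<Rightarrow>\<^sub>0 rat"

abbreviation lmonom :: "int \<times> int \<Rightarrow> laurent" where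
  "lmonom e \<equiv> Poly_Mapping.single e 1"

text \<open>
  A letter \<open>(g, True)\<close> is the generator with index \<open>g\<close>, and \<open>(g, False)\<close> is its inverse.
\<close>

type_synonym word = "(nat \<times> bool) list"

abbreviation gen :: "nat \<Rightarrow> word" where
  "gen g \<equiv> [(g, True)]"

definition word_inv :: "word \<Rightarrow> word" where
  "word_inv w = rev (map (\<lambda>(g, s). (g, \<not> s)) w)"

definition word_pow :: "word \<Rightarrow> nat \<Rightarrow> word" where
  "word_pow w n = concat (replicate n w)"

text \<open>
  \<open>fox \<phi> j w\<close> is the image in the Laurent ring, under the map of group rings induced by \<open>\<phi>\<close>,
  of the Fox derivative of \<open>w\<close> with respect to the generator \<open>j\<close>: the recursion is
  $\partial(uv) = \partial u + u\,\partial v$ and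
  $\partial_j(g^{-1}) = -g^{-1}\,\partial_j g$, with \<open>\<phi>\<close> applied.
\<close>

fun fox :: "(nat \<Rightarrow> int \<times> int) \<Rightarrow> nat \<Rightarrow> word \<Rightarrow> laurent" where
  "fox \<phi> j [] = 0"
| "fox \<phi> j ((g, True) # w) = (if g = j then 1 else 0) + lmonom (\<phi> g) * fox \<phi> j w"
| "fox \<phi> j ((g, False) # w) =
     (if g = j then - lmonom (- \<phi> g) else 0) + lmonom (- \<phi> g) * fox \<phi> j w"

definition fox_matrix :: "(nat \<Rightarrow> int \<times> int) \<Rightarrow> nat \<Rightarrow> word list \<Rightarrow> laurent mat" where
  "fox_matrix \<phi> n rels = mat (length rels) n (\<lambda>(i, j). fox \<phi> j (rels ! i))"

definition elementary_ideal ::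
    "nat \<Rightarrow> (nat \<Rightarrow> int \<times> int) \<Rightarrow> nat \<Rightarrow> word list \<Rightarrow> laurent set" where
  "elementary_ideal d \<phi> n rels = ideal_gen
     {det (submatrix (fox_matrix \<phi> n rels) I J) | I J.
        I \<subseteq> {..<length rels} \<and> J \<subseteq> {..<n} \<and> card I = n - d \<and> card J = n - d}"


section \<open>The group of the pretzel link $P(2k, 2r-1, 2m)$\<close>

text \<open>
  The link enters through the presentation $\langle a, b, c \mid r_1, r_2\rangle$ of its group; the
  generators $a, b, c$ have the indices \<open>0, 1, 2\<close>. Here $a$ is a positive meridian of the first
  component, and $b$ and $c$ are positive meridians of the second one.
\<close>

definition pretzel_rel1 :: "nat \<Rightarrow> nat \<Rightarrow> nat \<Rightarrow> word" where
  "pretzel_rel1 k r m =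
     (let a = gen 0; b = gen 1; c = gen 2 in
      word_pow (c @ b) r @ word_inv b @ word_inv (word_pow (c @ b) r) @
      word_pow (a @ word_inv c) m @ c @ word_pow (c @ word_inv a) m)"

definition pretzel_rel2 :: "nat \<Rightarrow> nat \<Rightarrow> nat \<Rightarrow> word" where
  "pretzel_rel2 k r m =
     (let a = gen 0; b = gen 1; c = gen 2 in
      word_inv (word_pow (a @ b) k) @ b @ word_pow (a @ b) k @
      word_pow (c @ b) (r - 1) @ word_inv c @ word_inv (word_pow (c @ b) (r - 1)))"

definition pretzel_phi :: "nat \<Rightarrow> int \<times> int" where
  "pretzel_phi g = (if g = 0 then (1, 0) else (0, 1))"

definition pretzel_E2 :: "nat \<Rightarrow> nat \<Rightarrow> nat \<Rightarrow> laurent set" where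
  "pretzel_E2 k r m = elementary_ideal 2 pretzel_phi 3 [pretzel_rel1 k r m, pretzel_rel2 k r m]"


section \<open>The polynomial ring in $x$ and $y$\<close>

text \<open>
  $R = \mathbb{Q}[x, y]$ is represented as $\mathbb{Q}[x][y]$, so \<open>coeff (coeff p i) j\<close> is the
  coefficient of $y^i x^j$, and \<open>[:f:]\<close> is the polynomial $f(x)$ viewed in $R$.
\<close>

type_synonym biv = "rat poly poly"

definition xR :: biv where "xR = [:[:0, 1:]:]"

definition yR :: biv where "yR = [:0, 1:]"

definition to_laurent :: "biv \<Rightarrow> laurent" where
  "to_laurent p = (\<Sum>i\<le>degree p. \<Sum>j\<le>degree (coeff p i).
     Poly_Mapping.single (int i, int j) (coeff (coeff p i) j))"

definition pretzel_ideal :: "nat \<Rightarrow> nat \<Rightarrow> nat \<Rightarrow> biv set" where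
  "pretzel_ideal k r m = {p. to_laurent p \<in> pretzel_E2 k r m}"

text \<open>The divisions in the next three definitions are exact (for odd \<open>q\<close> in the first).\<close>

definition A_poly :: "nat \<Rightarrow> rat poly" where
  "A_poly q = (1 + [:0, 1:] ^ q) div (1 + [:0, 1:])"

definition G_poly :: "nat \<Rightarrow> biv" where
  "G_poly k = (1 - (xR * yR) ^ k) div (1 - xR * yR)"

definition H_poly :: "nat \<Rightarrow> biv" where
  "H_poly m = (xR ^ m - yR ^ m) div (xR - yR)"


section \<open>Reduced Groebner bases for the lexicographic order $y > x$\<close>

definition monoms :: "biv \<Rightarrow> (nat \<times> nat) set" where
  "monoms p = {(i, j). coeff (coeff p i) j \<noteq> 0}"

definition lead_monom :: "biv \<Rightarrow> nat \<times> nat" where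
  "lead_monom p = (THE s. s \<in> monoms p \<and>
     (\<forall>t \<in> monoms p. t = s \<or> (t, s) \<in> less_than <*lex*> less_than))"

definition lead_cf :: "biv \<Rightarrow> rat" where
  "lead_cf p = (case lead_monom p of (i, j) \<Rightarrow> coeff (coeff p i) j)"

definition monom_dvd :: "nat \<times> nat \<Rightarrow> nat \<times> nat \<Rightarrow> bool" where
  "monom_dvd s t \<longleftrightarrow> fst s \<le> fst t \<and> snd s \<le> snd t"

definition groebner_basis :: "biv set \<Rightarrow> biv set \<Rightarrow> bool" where
  "groebner_basis I G \<longleftrightarrow> finite G \<and> G \<subseteq> I \<and> 0 \<notin> G \<and>
     (\<forall>f\<in>I. f \<noteq> 0 \<longrightarrow> (\<exists>g\<in>G. monom_dvd (lead_monom g) (lead_monom f)))"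

definition reduced_groebner_basis :: "biv set \<Rightarrow> biv set \<Rightarrow> bool" where
  "reduced_groebner_basis I G \<longleftrightarrow> groebner_basis I G \<and>
     (\<forall>g\<in>G. lead_cf g = 1 \<and>
        (\<forall>g' \<in> G - {g}. \<forall>t \<in> monoms g. \<not> monom_dvd (lead_monom g') t))"

definition AG2 :: "nat \<Rightarrow> nat \<Rightarrow> nat \<Rightarrow> biv set" where
  "AG2 k r m = (THE G. reduced_groebner_basis (pretzel_ideal k r m) G)"


section \<open>The fields $\mathcal{K}_\delta$ and the polynomials $p_\delta$\<close>

definition cyclotomic :: "nat \<Rightarrow> rat poly" where
  "cyclotomic n = (THE p. map_poly of_rat p =
     (\<Prod>z | z ^ n = 1 \<and> (\<forall>i. 0 < i \<and> i < n \<longrightarrow> z ^ i \<noteq> 1). [:- z, 1 :: complex:]))"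

text \<open>
  $\mathcal{K}_\delta = \mathbb{Q}[x]/(\Phi_{2\delta})$ is modelled by the canonical representatives
  of degree less than that of $\Phi_{2\delta}$, with multiplication modulo $\Phi_{2\delta}$.
  Accordingly \<open>K_polys \<delta>\<close> is the ring $\mathcal{K}_\delta[y]$, whose product of \<open>p\<close> and \<open>q\<close> is
  \<open>K_red \<delta> (p * q)\<close>; since $\Phi_{2\delta}$ is not constant, degree in $y$ and leading coefficient
  of an element are those of its representative. For \<open>p = p(x, y)\<close> in $R$, \<open>K_red \<delta> p\<close> is the
  polynomial $p(x_\delta, y)$.
\<close>

definition K_polys :: "nat \<Rightarrow> biv set" where
  "K_polys \<delta> = {p. \<forall>i. degree (coeff p i) < degree (cyclotomic (2 * \<delta>))}"

definition K_red :: "nat \<Rightarrow> biv \<Rightarrow> biv" where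
  "K_red \<delta> p = map_poly (\<lambda>c. c mod cyclotomic (2 * \<delta>)) p"

definition K_dvd :: "nat \<Rightarrow> biv \<Rightarrow> biv \<Rightarrow> bool" where
  "K_dvd \<delta> p q \<longleftrightarrow> (\<exists>c \<in> K_polys \<delta>. q = K_red \<delta> (p * c))"

definition K_monic_gcd :: "nat \<Rightarrow> biv \<Rightarrow> biv \<Rightarrow> biv \<Rightarrow> bool" where
  "K_monic_gcd \<delta> f g p \<longleftrightarrow> p \<in> K_polys \<delta> \<and> lead_coeff p = 1 \<and> K_dvd \<delta> p f \<and> K_dvd \<delta> p g \<and>
     (\<forall>c \<in> K_polys \<delta>. K_dvd \<delta> c f \<and> K_dvd \<delta> c g \<longrightarrow> K_dvd \<delta> c p)"

definition p_delta :: "nat \<Rightarrow> nat \<Rightarrow> nat \<Rightarrow> biv" where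
  "p_delta k m \<delta> = (THE p. K_monic_gcd \<delta> (K_red \<delta> (G_poly k)) (K_red \<delta> (H_poly m)) p)"

definition d_delta :: "nat \<Rightarrow> nat \<Rightarrow> nat \<Rightarrow> nat" where
  "d_delta k m \<delta> = degree (p_delta k m \<delta>)"

definition D_set :: "nat \<Rightarrow> nat \<Rightarrow> nat \<Rightarrow> nat set" where
  "D_set k q m = {\<delta>. \<delta> > 1 \<and> \<delta> dvd q \<and> d_delta k m \<delta> > 0}"

definition Pi0 :: "nat \<Rightarrow> nat \<Rightarrow> nat \<Rightarrow> rat poly" where
  "Pi0 k q m = (\<Prod>\<delta> \<in> D_set k q m. cyclotomic (2 * \<delta>))"

text \<open>\<open>cong_x_powi P f e\<close> says that $f \equiv x^e$ modulo $P$, where $x$ is invertible modulo $P$.\<close>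

definition cong_x_powi :: "rat poly \<Rightarrow> rat poly \<Rightarrow> int \<Rightarrow> bool" where
  "cong_x_powi P f e \<longleftrightarrow>
     (if e \<ge> 0 then [f = [:0, 1:] ^ nat e] (mod P) else [f * [:0, 1:] ^ nat (- e) = 1] (mod P))"

definition h_poly :: "nat \<Rightarrow> nat \<Rightarrow> nat \<Rightarrow> int \<Rightarrow> rat poly" where
  "h_poly k q m e = (THE f. degree f < degree (Pi0 k q m) \<and> cong_x_powi (Pi0 k q m) f e)"

end

theory Submission
  imports Defs "Jordan_Normal_Form.Char_Poly" "HOL-Computational_Algebra.Field_as_Ring"
begin

text \<open>
  For three generators and two relators, $E_2$ is generated by the six Fox derivatives.
  Both relators of $P(2k, 2r-1, 2m)$ are products of two conjugates, and in a commutative group ring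
  the Fox derivative of a conjugate collapses to two terms. What remains are geometric sums: up to
  units, the six derivatives are $A_q$ twice, $(1-x)G_k$, $(1-x)H_m$, and $A_q$ plus multiples of
  $(1-y)G_k$ and $(y-1)H_m$. Since $A_q(1) = 1$, the factor $1-x$ is invertible modulo $A_q$, so
  $E_2 = \langle A_q, G_k, H_m\rangle$ in the Laurent ring (\<open>fox_ideal_generators\<close>). As
  $G_k \equiv 1$ modulo $xy$, the product $xy$ is invertible modulo the ideal with the same generators
  in $\mathbb{Q}[x,y]$, and contracting from the Laurent ring adds nothing to it
  (\<open>laurent_ideal_contraction\<close>).

  Modulo $G_k$ and $H_m$ one has $(xy)^k = 1$ and $x^m = y^m$, and $um + vk = 1$ turns these two
  relations into $y = x^e$ (\<open>yR_cong_x_powi\<close>). If the polynomial $E(x)$ represents $x^e$ modulo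
  a divisor $P$ of $A_q$, substitution of $E$ for $y$ gives
  \[ \langle P, G_k, H_m\rangle = \langle \gcd(P, G_k(x,E), H_m(x,E)),\; y - E\rangle , \]
  so that everything is decided by one gcd in $\mathbb{Q}[x]$ (\<open>ideal_gen_eliminate_y\<close>).

  This gcd is read off from complex roots. The roots of $A_q$ are simple, and they are the primitive
  $2\delta$-th roots of unity with $\delta \mid q$ and $\delta > 1$. At such a root $z$ one has
  $E(z) = z^e$; because $e + 1 = 2um$ and $e - 1 = -2vk$, the values $G_k(z, z^e)$ and $H_m(z, z^e)$
  are, up to nonzero factors, geometric sums of length $k$ and $m$ with ratios $z^{2um}$ and
  $z^{2vk}$. Both vanish exactly when $\delta$ divides $mk$ but neither $m$ nor $k$
  (\<open>common_root_iff\<close>), a condition on $\delta$ alone. Two choices of $P$ are of interest.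
   \<^item> For $P = \Phi_{2\delta}$ the gcd is $\Phi_{2\delta}$ or $1$, so $p_\delta$ is $y - x^e$ or $1$.
     This determines $\mathcal{D}$ (\<open>d_delta_eq\<close>).
   \<^item> For $P = A_q$ the gcd is the product of the $\Phi_{2\delta}$ with $\delta \in \mathcal{D}$,
     which is $\Pi_0$ (\<open>Pi0_eq_gcd\<close>).

  Finally, an ideal $\langle \Pi_0, y - h\rangle$ with $\deg h < \deg\Pi_0$ has $y$ and
  $x^{\deg\Pi_0}$ as its minimal leading monomials, and this forces its reduced Groebner basis
  (\<open>reduced_groebner_basis_shape\<close>).
\<close>

section \<open>Ideals and congruences\<close>

lemma ring_module: "Modules.module ((*) :: 'a::comm_ring_1 \<Rightarrow> 'a \<Rightarrow> 'a)"
  by unfold_locales (simp_all add: algebra_simps)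

definition ideal_cong :: "'a::comm_ring_1 set \<Rightarrow> 'a \<Rightarrow> 'a \<Rightarrow> bool" where
  "ideal_cong S a b \<longleftrightarrow> a - b \<in> ideal_gen S"

lemma ideal_gen_base: "a \<in> S \<Longrightarrow> a \<in> ideal_gen S"
  unfolding ideal_gen_def by (rule module.span_base[OF ring_module])

lemma ideal_gen_zero [simp]: "0 \<in> ideal_gen S"
  unfolding ideal_gen_def by (rule module.span_zero[OF ring_module])

lemma ideal_gen_add: "a \<in> ideal_gen S \<Longrightarrow> b \<in> ideal_gen S \<Longrightarrow> a + b \<in> ideal_gen S"
  unfolding ideal_gen_def by (rule module.span_add[OF ring_module])

lemma ideal_gen_diff: "a \<in> ideal_gen S \<Longrightarrow> b \<in> ideal_gen S \<Longrightarrow> a - b \<in> ideal_gen S"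
  unfolding ideal_gen_def by (rule module.span_diff[OF ring_module])

lemma ideal_gen_mult_left: "a \<in> ideal_gen S \<Longrightarrow> c * a \<in> ideal_gen S"
  unfolding ideal_gen_def by (rule module.span_scale[OF ring_module])

lemma ideal_gen_mult_right: "a \<in> ideal_gen S \<Longrightarrow> a * c \<in> ideal_gen S"
  using ideal_gen_mult_left[of a S c] by (simp add: mult.commute)

lemma ideal_gen_dvd: "a \<in> ideal_gen S \<Longrightarrow> a dvd b \<Longrightarrow> b \<in> ideal_gen S"
  by (auto elim!: dvdE intro: ideal_gen_mult_right)

lemma ideal_gen_subsetI: "S \<subseteq> ideal_gen T \<Longrightarrow> ideal_gen S \<subseteq> ideal_gen T"
  unfolding ideal_gen_def
  by (metis module.span_minimal[OF ring_module] module.subspace_span[OF ring_module])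

lemma ideal_gen_eqI: "S \<subseteq> ideal_gen T \<Longrightarrow> T \<subseteq> ideal_gen S \<Longrightarrow> ideal_gen S = ideal_gen T"
  by (intro subset_antisym ideal_gen_subsetI)

lemma ideal_gen_one: "1 \<in> ideal_gen S \<Longrightarrow> ideal_gen S = UNIV"
  using ideal_gen_mult_left[of 1 S] by auto

lemma ideal_gen_insert_iff: "a \<in> ideal_gen (insert b S) \<longleftrightarrow> (\<exists>c. a - c * b \<in> ideal_gen S)"
  unfolding ideal_gen_def by (simp add: module.span_insert[OF ring_module])

lemma ideal_gen_empty [simp]: "ideal_gen {} = {0}"
  unfolding ideal_gen_def by (rule module.span_empty[OF ring_module])

lemma ideal_gen_pair_iff: "a \<in> ideal_gen {b, c} \<longleftrightarrow> (\<exists>\<beta> \<gamma>. a = \<beta> * b + \<gamma> * c)"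
  by (auto simp: ideal_gen_insert_iff algebra_simps)

lemma ideal_cong_refl [simp]: "ideal_cong S a a"
  by (simp add: ideal_cong_def)

lemma ideal_cong_sym: "ideal_cong S a b \<Longrightarrow> ideal_cong S b a"
  unfolding ideal_cong_def using ideal_gen_diff[of 0 S "a - b"] by simp

lemma ideal_cong_trans [trans]: "ideal_cong S a b \<Longrightarrow> ideal_cong S b c \<Longrightarrow> ideal_cong S a c"
  unfolding ideal_cong_def using ideal_gen_add[of "a - b" S "b - c"] by simp

lemma ideal_cong_mult: "ideal_cong S a b \<Longrightarrow> ideal_cong S c d \<Longrightarrow> ideal_cong S (a * c) (b * d)"
proof -
  assume "ideal_cong S a b" "ideal_cong S c d"
  then have "(a - b) * c + b * (c - d) \<in> ideal_gen S"
    unfolding ideal_cong_def by (intro ideal_gen_add ideal_gen_mult_left ideal_gen_mult_right)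
  then show ?thesis
    unfolding ideal_cong_def by (simp add: algebra_simps)
qed

lemma ideal_cong_power: "ideal_cong S a b \<Longrightarrow> ideal_cong S (a ^ n) (b ^ n)"
  by (induction n) (auto intro: ideal_cong_mult)

lemma ideal_cong_mem_iff: "ideal_cong S a b \<Longrightarrow> a \<in> ideal_gen S \<longleftrightarrow> b \<in> ideal_gen S"
  unfolding ideal_cong_def using ideal_gen_add[of "a - b" S b] ideal_gen_diff[of a S "a - b"] by auto

section \<open>Polynomials inside the Laurent ring\<close>

interpretation laurent_const: comm_ring_hom "Poly_Mapping.single 0 :: rat \<Rightarrow> laurent"
  by unfold_locales (simp_all add: single_add mult_single)

definition laurent_of_x :: "rat poly \<Rightarrow> laurent" where
  "laurent_of_x c = eval_poly (Poly_Mapping.single 0) c (lmonom (0, 1))"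

interpretation laurent_const_poly: map_poly_comm_ring_hom "Poly_Mapping.single 0 :: rat \<Rightarrow> laurent" ..

interpretation laurent_of_x: comm_ring_hom laurent_of_x
  unfolding laurent_of_x_def eval_poly_def by unfold_locales (simp_all add: hom_distribs)

interpretation laurent_of_x_poly: map_poly_comm_ring_hom laurent_of_x ..

lemma lmonom_power: "lmonom (a, b) ^ n = lmonom (int n * a, int n * b)"
  by (induction n) (simp_all add: mult_single algebra_simps flip: zero_prod_def)

text \<open>
  In the form of an iterated evaluation, \<open>to_laurent\<close> is visibly a ring homomorphism.
\<close>

lemma to_laurent_conv_eval: "to_laurent p = eval_poly laurent_of_x p (lmonom (1, 0))"
  unfolding to_laurent_def
  by (simp add: eval_poly_as_sum laurent_of_x_def lmonom_power mult_single sum_distrib_left)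

interpretation to_laurent: comm_ring_hom to_laurent
  unfolding to_laurent_conv_eval[abs_def] eval_poly_def
  by unfold_locales (simp_all add: hom_distribs)

lemma to_laurent_monom: "to_laurent (monom (monom c j) i) = Poly_Mapping.single (int i, int j) c"
  by (simp add: to_laurent_conv_eval laurent_of_x_def laurent_of_x.eval_poly_monom
      laurent_const.eval_poly_monom lmonom_power mult_single)

lemma to_laurent_xR: "to_laurent xR = lmonom (0, 1)"
  using to_laurent_monom[of 1 1 0] by (simp add: xR_def monom_altdef)

lemma to_laurent_yR: "to_laurent yR = lmonom (1, 0)"
  using to_laurent_monom[of 1 0 1] by (simp add: yR_def monom_altdef flip: one_pCons)

lemma lookup_to_laurent: "Poly_Mapping.lookup (to_laurent p) (int i, int j) = coeff (coeff p i) j"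
proof -
  have "Poly_Mapping.lookup (to_laurent p) (int i, int j) =
    (\<Sum>i'\<le>degree p. if i' = i
       then \<Sum>j'\<le>degree (coeff p i). if j' = j then coeff (coeff p i) j else 0 else 0)"
    unfolding to_laurent_def Poly_Mapping.lookup_sum
    by (intro sum.cong refl) (auto simp: lookup_single when_def intro!: sum.cong)
  also have "\<dots> = coeff (coeff p i) j"
    by (auto simp: coeff_eq_0)
  finally show ?thesis .
qed

lemma to_laurent_eqD: "to_laurent p = to_laurent p' \<Longrightarrow> p = p'"
  by (intro poly_eqI) (metis lookup_to_laurent)

lemma laurent_clear_denominator: "\<exists>N p. to_laurent ((xR * yR) ^ N) * f = to_laurent p"
proof (induction f rule: update_induct)
  case const
  have "to_laurent ((xR * yR) ^ 0) * 0 = to_laurent 0" by simp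
  then show ?case by blast
next
  case (update f a b)
  from update obtain N p where p: "to_laurent ((xR * yR) ^ N) * f = to_laurent p" by blast
  obtain i j where a: "a = (i, j)" by force
  \<comment> \<open>One shift that makes both exponents nonnegative.\<close>
  define M where "M = nat \<bar>i\<bar> + nat \<bar>j\<bar>"
  have f: "Poly_Mapping.update a b f = f + Poly_Mapping.single a b"
    using update(1) by (intro poly_mapping_eqI)
      (auto simp: lookup_update lookup_add lookup_single in_keys_iff when_def)
  have "to_laurent ((xR * yR) ^ M) = lmonom (int M, int M)"
    by (simp add: to_laurent.hom_power to_laurent.hom_mult to_laurent_xR to_laurent_yR mult_single
        lmonom_power)
  then have M: "to_laurent ((xR * yR) ^ M) * Poly_Mapping.single a b =
      to_laurent (monom (monom b (nat (int M + j))) (nat (int M + i)))"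
    by (auto simp: a to_laurent_monom mult_single M_def)
  have "to_laurent ((xR * yR) ^ (N + M)) * Poly_Mapping.update a b f =
     to_laurent ((xR * yR) ^ M) * (to_laurent ((xR * yR) ^ N) * f) +
     to_laurent ((xR * yR) ^ N) * (to_laurent ((xR * yR) ^ M) * Poly_Mapping.single a b)"
    by (simp add: f power_add to_laurent.hom_mult algebra_simps)
  also have "\<dots> = to_laurent ((xR * yR) ^ M * p +
      (xR * yR) ^ N * monom (monom b (nat (int M + j))) (nat (int M + i)))"
    by (simp only: p M to_laurent.hom_mult to_laurent.hom_add)
  finally show ?case by blast
qed

text \<open>
  A membership in the Laurent ring has finitely many coefficients; a power of $xy$ clears their
  denominators, and is then cancelled because $xy$ is invertible modulo \<open>S\<close>.
\<close>

lemma laurent_ideal_contraction: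
  assumes "finite S" and unit: "ideal_cong S (xR * yR * w) 1"
  shows "to_laurent p \<in> ideal_gen (to_laurent ` S) \<longleftrightarrow> p \<in> ideal_gen S"
proof
  have "\<exists>N. (xR * yR) ^ N * p \<in> ideal_gen S"
    if "finite S" "to_laurent p \<in> ideal_gen (to_laurent ` S)" for p S
    using that
  proof (induction S arbitrary: p rule: finite_induct)
    case empty
    then have "p = 0" by (auto intro: to_laurent_eqD)
    then show ?case by auto
  next
    case (insert s S)
    from insert.prems obtain c where c: "to_laurent p - c * to_laurent s \<in> ideal_gen (to_laurent ` S)"
      by (auto simp: ideal_gen_insert_iff)
    obtain N q where q: "to_laurent ((xR * yR) ^ N) * c = to_laurent q"
      using laurent_clear_denominator by blast
    have "to_laurent ((xR * yR) ^ N * p - q * s) =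
        to_laurent ((xR * yR) ^ N) * (to_laurent p - c * to_laurent s)"
      by (simp add: to_laurent.hom_mult to_laurent.hom_minus q algebra_simps flip: q)
    then have "to_laurent ((xR * yR) ^ N * p - q * s) \<in> ideal_gen (to_laurent ` S)"
      using c by (simp add: ideal_gen_mult_left)
    then obtain M where "(xR * yR) ^ M * ((xR * yR) ^ N * p - q * s) \<in> ideal_gen S"
      using insert.IH by blast
    then have "(xR * yR) ^ (M + N) * p - ((xR * yR) ^ M * q) * s \<in> ideal_gen S"
      by (simp add: algebra_simps power_add)
    then show ?case
      unfolding ideal_gen_insert_iff by blast
  qed
  moreover assume "to_laurent p \<in> ideal_gen (to_laurent ` S)"
  ultimately obtain N where N: "(xR * yR) ^ N * p \<in> ideal_gen S"
    using assms(1) by blast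
  have "ideal_cong S ((xR * yR * w) ^ N * p) (1 ^ N * p)"
    by (intro ideal_cong_mult ideal_cong_power unit ideal_cong_refl)
  moreover have "(xR * yR * w) ^ N * p = w ^ N * ((xR * yR) ^ N * p)"
    by (simp add: power_mult_distrib mult_ac)
  ultimately show "p \<in> ideal_gen S"
    using N by (metis ideal_cong_mem_iff ideal_gen_mult_left mult_1 power_one)
next
  assume "p \<in> ideal_gen S"
  with \<open>finite S\<close> show "to_laurent p \<in> ideal_gen (to_laurent ` S)"
  proof (induction S arbitrary: p rule: finite_induct)
    case (insert s S)
    from insert.prems obtain c where "p - c * s \<in> ideal_gen S"
      by (auto simp: ideal_gen_insert_iff)
    then have "to_laurent (p - c * s) \<in> ideal_gen (to_laurent ` S)"
      by (rule insert.IH)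
    then show ?case
      by (auto simp: ideal_gen_insert_iff to_laurent.hom_mult to_laurent.hom_minus)
  qed simp
qed

section \<open>Fox calculus\<close>

definition word_val :: "(nat \<Rightarrow> int \<times> int) \<Rightarrow> word \<Rightarrow> laurent" where
  "word_val \<phi> w = prod_list (map (\<lambda>(g, s). lmonom (if s then \<phi> g else - \<phi> g)) w)"

lemma word_val_simps [simp]:
  "word_val \<phi> [] = 1"
  "word_val \<phi> ((g, True) # w) = lmonom (\<phi> g) * word_val \<phi> w"
  "word_val \<phi> ((g, False) # w) = lmonom (- \<phi> g) * word_val \<phi> w"
  "word_val \<phi> (u @ w) = word_val \<phi> u * word_val \<phi> w"
  by (simp_all add: word_val_def)

lemma lmonom_inverse: "lmonom (- a) * lmonom a = 1" "lmonom a * lmonom (- a) = 1"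
  by (simp_all add: mult_single)

lemma word_inv_simps [simp]:
  "word_inv [] = []" "word_inv ((g, s) # w) = word_inv w @ [(g, \<not> s)]"
  "word_inv (u @ w) = word_inv w @ word_inv u"
  by (simp_all add: word_inv_def)

lemma word_inv_word_inv [simp]: "word_inv (word_inv w) = w"
  by (induction w) auto

lemma word_val_word_inv: "word_val \<phi> (word_inv w) * word_val \<phi> w = 1"
proof (induction w)
  case (Cons l w)
  obtain g s where l: "l = (g, s)" by force
  have "word_val \<phi> (word_inv (l # w)) * word_val \<phi> (l # w) =
      (word_val \<phi> (word_inv w) * word_val \<phi> w) * (lmonom (- \<phi> g) * lmonom (\<phi> g))"
    by (cases s) (simp_all add: l mult_ac del: single_one)
  then show ?case using Cons by (simp add: lmonom_inverse)
qed simp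

lemma word_pow_0 [simp]: "word_pow w 0 = []"
  and word_pow_Suc [simp]: "word_pow w (Suc n) = w @ word_pow w n"
  by (simp_all add: word_pow_def)

lemma word_pow_Suc_right: "word_pow w (Suc n) = word_pow w n @ w"
  by (induction n) simp_all

lemma word_inv_word_pow: "word_inv (word_pow w n) = word_pow (word_inv w) n"
  by (induction n) (simp, metis word_inv_simps(3) word_pow_Suc word_pow_Suc_right)

lemma word_val_word_pow: "word_val \<phi> (word_pow w n) = word_val \<phi> w ^ n"
  by (induction n) simp_all

lemma fox_append: "fox \<phi> j (u @ w) = fox \<phi> j u + word_val \<phi> u * fox \<phi> j w"
proof (induction u)
  case (Cons l u)
  obtain g s where "l = (g, s)" by force
  with Cons show ?case by (cases s) (simp_all add: algebra_simps)
qed simp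

text \<open>
  The word $w^{-1}w$ has derivative $0$, since removing the cancelling pair in its middle changes nothing.
  The product rule then gives the derivative of $w^{-1}$.
\<close>

lemma fox_word_inv: "fox \<phi> j (word_inv w) = - word_val \<phi> (word_inv w) * fox \<phi> j w"
proof -
  have "fox \<phi> j (word_inv w @ w) = 0"
  proof (induction w)
    case (Cons l w)
    obtain g s where l: "l = (g, s)" by force
    have mid: "fox \<phi> j ((g, \<not> s) # (g, s) # v) = fox \<phi> j v" for v
      using lmonom_inverse(1)[of "\<phi> g"] lmonom_inverse(2)[of "\<phi> g"]
      by (cases s) (auto simp: distrib_left simp flip: mult.assoc simp del: mult_single)
    have "word_inv (l # w) @ (l # w) = word_inv w @ (g, \<not> s) # (g, s) # w"
      by (simp add: l)
    then show ?case
      using Cons by (simp add: fox_append mid del: fox.simps)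
  qed simp
  then show ?thesis
    by (simp add: fox_append add_eq_0_iff)
qed

lemma fox_word_pow: "fox \<phi> j (word_pow w n) = (\<Sum>i<n. word_val \<phi> w ^ i) * fox \<phi> j w"
proof (induction n)
  case (Suc n)
  have "(\<Sum>i<Suc n. word_val \<phi> w ^ i) = (\<Sum>i<n. word_val \<phi> w ^ i) + word_val \<phi> w ^ n" by simp
  with Suc show ?case
    by (simp add: fox_append word_pow_Suc_right word_val_word_pow algebra_simps del: word_pow_Suc)
qed simp

text \<open>
  Since the Laurent ring is commutative, conjugate words have the same image in it. This is what makes
  the derivatives of the relators short.
\<close>

lemma word_val_conj: "word_val \<phi> (u @ w @ word_inv u) = word_val \<phi> w"
proof -
  have "word_val \<phi> (u @ w @ word_inv u) = word_val \<phi> w * (word_val \<phi> (word_inv u) * word_val \<phi> u)"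
    by (simp add: mult_ac)
  then show ?thesis
    by (simp add: word_val_word_inv)
qed

lemma fox_conj:
  "fox \<phi> j (u @ w @ word_inv u) = (1 - word_val \<phi> w) * fox \<phi> j u + word_val \<phi> u * fox \<phi> j w"
proof -
  have "fox \<phi> j (u @ w @ word_inv u) = fox \<phi> j u + word_val \<phi> u * fox \<phi> j w
      - (word_val \<phi> (word_inv u) * word_val \<phi> u) * word_val \<phi> w * fox \<phi> j u"
    by (simp add: fox_append fox_word_inv algebra_simps)
  also have "\<dots> = (1 - word_val \<phi> w) * fox \<phi> j u + word_val \<phi> u * fox \<phi> j w"
    unfolding word_val_word_inv by (simp add: algebra_simps)
  finally show ?thesis .
qed

text \<open>
  With one generator more than \<open>d\<close> the minors have size $1 \times 1$ and are the entries of the Fox matrix.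
\<close>

lemma elementary_ideal_entries:
  assumes "Suc d = n"
  shows "elementary_ideal d \<phi> n rels =
    ideal_gen {fox \<phi> j w | j w. j < n \<and> w \<in> set rels}"
proof -
  have minor: "det (submatrix (fox_matrix \<phi> n rels) {i} {j}) = fox \<phi> j (rels ! i)"
    if "i < length rels" "j < n" for i j
  proof -
    define M where "M = fox_matrix \<phi> n rels"
    have M: "dim_row M = length rels" "dim_col M = n" "M $$ (i, j) = fox \<phi> j (rels ! i)"
      using that by (simp_all add: M_def fox_matrix_def)
    have row: "{i'. i' < dim_row M \<and> i' \<in> {i}} = {i}" and col: "{j'. j' < dim_col M \<and> j' \<in> {j}} = {j}"
      using that M by auto
    have "submatrix M {i} {j} = mat 1 1 (\<lambda>(a, b). M $$ (pick {i} a, pick {j} b))"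
      unfolding submatrix_def row col by simp
    moreover have "pick {i} 0 = i" "pick {j} 0 = j"
      by (auto intro: Least_equality)
    ultimately have "det (submatrix M {i} {j}) = M $$ (i, j)"
      using det_single[of "submatrix M {i} {j}"] by simp
    then show ?thesis
      by (simp add: M flip: M_def)
  qed
  have nd: "n - d = 1"
    using assms by simp
  have "{det (submatrix (fox_matrix \<phi> n rels) I J) | I J.
      I \<subseteq> {..<length rels} \<and> J \<subseteq> {..<n} \<and> card I = n - d \<and> card J = n - d} =
    {fox \<phi> j w | j w. j < n \<and> w \<in> set rels}" (is "?L = ?R")
  proof (intro subset_antisym subsetI)
    fix f assume "f \<in> ?L"
    then obtain I J where IJ: "f = det (submatrix (fox_matrix \<phi> n rels) I J)"
        "I \<subseteq> {..<length rels}" "J \<subseteq> {..<n}" "card I = 1" "card J = 1"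
      unfolding nd by blast
    from IJ(4,5) obtain i j where "I = {i}" "J = {j}"
      by (meson card_1_singletonE)
    with IJ have "f = fox \<phi> j (rels ! i)" "i < length rels" "j < n"
      by (simp_all add: minor)
    then show "f \<in> ?R"
      using nth_mem by blast
  next
    fix f assume "f \<in> ?R"
    then obtain j i where "f = fox \<phi> j (rels ! i)" "j < n" "i < length rels"
      by (auto simp: in_set_conv_nth)
    then have "f = det (submatrix (fox_matrix \<phi> n rels) {i} {j})"
        "{i} \<subseteq> {..<length rels}" "{j} \<subseteq> {..<n}" "card {i} = n - d" "card {j} = n - d"
      by (simp_all add: minor nd)
    then show "f \<in> ?L"
      by blast
  qed
  then show ?thesis
    by (simp add: elementary_ideal_def)
qed

section \<open>The elementary ideal of the pretzel link\<close>

text \<open>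
  For $q = 2s + 1$ the left-hand side is $A_q$, while the sum over powers of $X^2$ is what the Fox
  derivative of $(cb)^s$ produces.
\<close>

lemma alternating_geometric_sum:
  fixes X :: "'a::comm_ring_1"
  shows "(\<Sum>i<2 * s + 1. (- X) ^ i) = (1 - X) * (\<Sum>i<s. (X * X) ^ i) + (X * X) ^ s"
proof (induction s)
  case (Suc s)
  have "(\<Sum>i<2 * Suc s + 1. (- X) ^ i) =
      (\<Sum>i<2 * s + 1. (- X) ^ i) - X * (X * X) ^ s + (X * X) ^ Suc s"
    by (simp add: power_mult power2_eq_square)
  then show ?case
    unfolding Suc by (simp add: algebra_simps)
qed simp

text \<open>
  The computation behind $E_2 = \langle A_q, G_k, H_m\rangle$, over an arbitrary commutative ring.
  Here \<open>X'\<close> is $x^{-1}$, \<open>u\<close> is $(yx)^k$ with inverse \<open>u'\<close>, \<open>t\<close> is $(yx^{-1})^m$, and \<open>T\<close> is $H_m$ up to a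
  unit. The hypotheses \<open>e10\<close> to \<open>e22\<close> list the Fox derivatives as the conjugation rule delivers them;
  \<open>e12\<close> and \<open>e21\<close> become $A_q$ plus a multiple of \<open>T\<close> or \<open>G\<close> once \<open>t\<close> and \<open>u\<close> are expanded by the geometric
  sum formula. The factor $1 - X$ in \<open>e10\<close> and \<open>e20\<close> is removed with the identity
  $1 = A_q + X S (1 - X)$, which expresses $A_q(1) = 1$.
\<close>

lemma fox_ideal_generators:
  fixes X X' Y u u' A G T e10 e11 e12 e20 e21 e22 :: "'a::comm_ring_1" and s :: nat
  defines "A \<equiv> \<Sum>i<2 * s + 1. (- X) ^ i"
  defines "S \<equiv> \<Sum>i<s. (X * X) ^ i" and "S1 \<equiv> \<Sum>i<Suc s. (X * X) ^ i" and "Z \<equiv> (X * X) ^ s"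
  assumes X: "X * X' = 1" and u: "u * u' = 1"
    and T: "(Y * X' - 1) * T = t - 1" and G: "(Y * X - 1) * G = u - 1"
  assumes e10: "e10 = X' * ((1 - X) * T)"
    and e11: "e11 = (1 - X') * (S1 * X) - X * X * Z * X'"
    and e12: "e12 = (1 - X') * S1 + X' * (t - (1 - X) * (T * (Y * X')))"
    and e20: "e20 = u' * ((X - 1) * G)"
    and e21: "e21 = u' * ((X - 1) * (G * Y) + 1) + X * ((1 - X') * (S * X))"
    and e22: "e22 = X * ((1 - X') * S - Z * X')"
  shows "ideal_gen {e10, e11, e12, e20, e21, e22} = ideal_gen {A, G, T}"
proof -
  have A: "A = (1 - X) * S + Z"
    unfolding A_def S_def Z_def by (rule alternating_geometric_sum)
  have S1: "S1 = S + Z" by (simp add: S1_def S_def Z_def)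
  have Z: "Z = 1 + (X * X - 1) * S"
    using power_diff_1_eq[of "X * X" s] by (simp add: Z_def S_def algebra_simps)
  have A': "1 = A + X * S * (1 - X)"
    by (simp add: A Z algebra_simps)
  have t: "t = 1 + (Y * X' - 1) * T" and u1: "u = 1 + (Y * X - 1) * G"
    by (simp_all add: T G)
  have E11: "e11 = - A"
  proof -
    have "e11 = (X - X * X') * S1 - X * Z * (X * X')"
      by (simp add: e11 algebra_simps)
    then show ?thesis by (simp add: X A S1 algebra_simps)
  qed
  have E22: "e22 = - A"
  proof -
    have "e22 = (X - X * X') * S - Z * (X * X')"
      by (simp add: e22 algebra_simps)
    then show ?thesis by (simp add: X A algebra_simps)
  qed
  have E12: "e12 = A + X' * (Y - 1) * T"
  proof -
    have "X * A - ((X - 1) * S1 + 1) = Z - (1 + (X * X - 1) * S)"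
      by (simp add: A S1 algebra_simps)
    then have XA: "(X - 1) * S1 + 1 = X * A"
      using Z by simp
    have "e12 = X' * ((X - 1) * S1 + 1) + (1 - X * X') * S1 + X' * (Y * (X * X') - 1) * T"
      by (simp add: e12 t algebra_simps)
    also have "X' * ((X - 1) * S1 + 1) = (X * X') * A"
      unfolding XA by (simp only: mult_ac)
    finally show ?thesis by (simp add: X)
  qed
  have E21: "e21 = A + u' * (1 - Y) * G"
  proof -
    have "e21 = u' * ((X - 1) * (G * Y) + (u - (Y * X - 1) * G)) + (X - X * X') * (S * X)"
      by (simp add: e21 u1 algebra_simps)
    also have "\<dots> = u * u' + u' * (1 - Y) * G + (X - X * X') * (S * X)"
      by (simp add: algebra_simps)
    also have "\<dots> = (1 - X * S * (1 - X)) + u' * (1 - Y) * G"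
      by (simp add: X u algebra_simps)
    also have "1 - X * S * (1 - X) = A"
      using A' by (metis add_diff_cancel_right')
    finally show ?thesis .
  qed
  show ?thesis
  proof (rule ideal_gen_eqI)
    let ?J = "ideal_gen {A, G, T}"
    have J: "A \<in> ?J" "G \<in> ?J" "T \<in> ?J" by (auto intro: ideal_gen_base)
    show "{e10, e11, e12, e20, e21, e22} \<subseteq> ?J"
      using J ideal_gen_diff[OF ideal_gen_zero J(1)]
      unfolding E11 E22 E12 E21 e10 e20
      by (auto intro!: ideal_gen_add ideal_gen_mult_left)
  next
    let ?J = "ideal_gen {e10, e11, e12, e20, e21, e22}"
    have J: "e10 \<in> ?J" "e20 \<in> ?J" "e11 \<in> ?J" by (auto intro: ideal_gen_base)
    have AJ: "A \<in> ?J"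
      using ideal_gen_mult_left[OF J(3), of "-1"] by (simp add: E11)
    have "G * A + (- X * S * u) * e20 = G * (A + X * S * (1 - X) * (u * u'))"
      by (simp add: e20 algebra_simps)
    then have "G = G * A + (- X * S * u) * e20"
      using A' by (simp add: u)
    also have "\<dots> \<in> ?J" by (intro ideal_gen_add ideal_gen_mult_left AJ J)
    finally have GJ: "G \<in> ?J" .
    have "T * A + (X * S * X) * e10 = T * (A + X * S * (1 - X) * (X * X'))"
      by (simp add: e10 algebra_simps)
    then have "T = T * A + (X * S * X) * e10"
      using A' by (simp add: X)
    also have "\<dots> \<in> ?J" by (intro ideal_gen_add ideal_gen_mult_left AJ J)
    finally have "T \<in> ?J" .
    with AJ GJ show "{A, G, T} \<subseteq> ?J" by simp
  qed
qed

interpretation const_poly: comm_ring_hom "\<lambda>c::'a::comm_ring_1. [:c:]"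
  by unfold_locales (simp_all add: one_pCons)

text \<open>
  The divisions in the definitions of $A_q$, $G_k$ and $H_m$ are exact, with geometric sums as quotients.
\<close>

lemma A_poly_eq:
  assumes "odd q"
  shows "A_poly q = (\<Sum>i<q. (- [:0, 1:]) ^ i)"
proof -
  have "1 + [:0, 1:] ^ q = (1 + [:0, 1:]) * (\<Sum>i<q. (- [:0, 1:]) ^ i :: rat poly)"
    using one_diff_power_eq[of "- [:0, 1:] :: rat poly" q]
    by (simp only: power_minus_odd[OF assms] diff_minus_eq_add)
  moreover have "poly (1 + [:0, 1:]) (0 :: rat) = 1"
    by simp
  then have "1 + [:0, 1:] \<noteq> (0 :: rat poly)"
    by (metis poly_0 zero_neq_one)
  ultimately show ?thesis
    unfolding A_poly_def by (metis nonzero_mult_div_cancel_left)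
qed

lemma G_poly_eq: "G_poly k = (\<Sum>i<k. (xR * yR) ^ i)"
proof -
  have "poly (1 - xR * yR) 0 = 1"
    by (simp add: xR_def yR_def)
  then have "1 - xR * yR \<noteq> 0"
    by (metis poly_0 zero_neq_one)
  then show ?thesis
    unfolding G_poly_def one_diff_power_eq by (rule nonzero_mult_div_cancel_left)
qed

lemma H_poly_eq: "H_poly m = (\<Sum>i<m. yR ^ (m - Suc i) * xR ^ i)"
proof -
  have "xR - yR \<noteq> 0"
    by (simp add: xR_def yR_def)
  then show ?thesis
    unfolding H_poly_def power_diff_sumr2 by (rule nonzero_mult_div_cancel_left)
qed

context
  fixes X X' Y :: laurent
  defines "X \<equiv> lmonom (0, 1)" and "X' \<equiv> lmonom (0, -1)" and "Y \<equiv> lmonom (1, 0)"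
begin

lemma lmonom_pretzel_phi:
  "lmonom (pretzel_phi 0) = Y" "lmonom (pretzel_phi 1) = X" "lmonom (pretzel_phi 2) = X"
  "lmonom (- pretzel_phi 1) = X'" "lmonom (- pretzel_phi 2) = X'"
  by (simp_all add: pretzel_phi_def X_def X'_def Y_def)

lemma X_X': "X * X' = 1"
  by (simp add: X_def X'_def mult_single flip: zero_prod_def)

text \<open>
  The relator is $P b^{-1} P^{-1} \cdot W c W^{-1}$ with $P = (cb)^r$ and $W = (ac^{-1})^m$.
\<close>

lemma fox_pretzel_rel1:
  "fox pretzel_phi j (pretzel_rel1 k r m) =
    (1 - X') * ((\<Sum>i<r. (X * X) ^ i) * fox pretzel_phi j [(2, True), (1, True)]) +
    (X * X) ^ r * fox pretzel_phi j [(1, False)] +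
    X' * ((1 - X) * ((\<Sum>i<m. (Y * X') ^ i) * fox pretzel_phi j [(0, True), (2, False)]) +
          (Y * X') ^ m * fox pretzel_phi j [(2, True)])"
proof -
  define P where "P = word_pow [(2, True), (1, True)] r"
  define W where "W = word_pow [(0, True), (2, False)] m"
  define U where "U = P @ [(1, False)] @ word_inv P"
  define V where "V = W @ [(2, True)] @ word_inv W"
  have U: "fox pretzel_phi j U =
      (1 - X') * fox pretzel_phi j P + word_val pretzel_phi P * fox pretzel_phi j [(1, False)]"
      "word_val pretzel_phi U = X'"
    unfolding U_def fox_conj word_val_conj by (simp_all only: word_val_simps lmonom_pretzel_phi mult_1_right)
  have V: "fox pretzel_phi j V =
      (1 - X) * fox pretzel_phi j W + word_val pretzel_phi W * fox pretzel_phi j [(2, True)]"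
    by (simp only: V_def fox_conj word_val_simps lmonom_pretzel_phi mult_1_right)
  have "pretzel_rel1 k r m = U @ V"
    by (simp add: pretzel_rel1_def Let_def U_def V_def P_def W_def word_inv_word_pow)
  then have "fox pretzel_phi j (pretzel_rel1 k r m) =
      (1 - X') * fox pretzel_phi j P + word_val pretzel_phi P * fox pretzel_phi j [(1, False)] +
      X' * ((1 - X) * fox pretzel_phi j W + word_val pretzel_phi W * fox pretzel_phi j [(2, True)])"
    by (simp only: fox_append U V)
  then show ?thesis
    by (simp only: P_def W_def fox_word_pow word_val_word_pow word_val_simps lmonom_pretzel_phi mult_1_right)
qed

text \<open>
  The relator is $Q^{-1} b\, Q \cdot P c^{-1} P^{-1}$ with $Q = (ab)^k$ and $P = (cb)^{r-1}$.
\<close>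

lemma fox_pretzel_rel2:
  fixes k :: nat
  defines "u' \<equiv> word_val pretzel_phi (word_inv (word_pow [(0, True), (1, True)] k))"
  shows "fox pretzel_phi j (pretzel_rel2 k r m) =
    u' * ((X - 1) * ((\<Sum>i<k. (Y * X) ^ i) * fox pretzel_phi j [(0, True), (1, True)]) +
          fox pretzel_phi j [(1, True)]) +
    X * ((1 - X') * ((\<Sum>i<r - 1. (X * X) ^ i) * fox pretzel_phi j [(2, True), (1, True)]) +
          (X * X) ^ (r - 1) * fox pretzel_phi j [(2, False)])"
    and "(Y * X) ^ k * u' = 1"
proof -
  define P where "P = word_pow [(2, True), (1, True)] (r - 1)"
  define Q where "Q = word_pow [(0, True), (1, True)] k"
  have u': "u' = word_val pretzel_phi (word_inv Q)"
    by (simp add: u'_def Q_def)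
  define U where "U = word_inv Q @ [(1, True)] @ word_inv (word_inv Q)"
  define V where "V = P @ [(2, False)] @ word_inv P"
  have U: "fox pretzel_phi j U =
      (1 - X) * fox pretzel_phi j (word_inv Q) + u' * fox pretzel_phi j [(1, True)]"
      "word_val pretzel_phi U = X"
    unfolding U_def u' fox_conj word_val_conj by (simp_all only: word_val_simps lmonom_pretzel_phi mult_1_right)
  have V: "fox pretzel_phi j V =
      (1 - X') * fox pretzel_phi j P + word_val pretzel_phi P * fox pretzel_phi j [(2, False)]"
    by (simp only: V_def fox_conj word_val_simps lmonom_pretzel_phi mult_1_right)
  have "pretzel_rel2 k r m = U @ V"
    by (simp add: pretzel_rel2_def Let_def U_def V_def P_def Q_def word_inv_word_pow)
  then have "fox pretzel_phi j (pretzel_rel2 k r m) =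
      ((1 - X) * fox pretzel_phi j (word_inv Q) + u' * fox pretzel_phi j [(1, True)]) +
      X * ((1 - X') * fox pretzel_phi j P + word_val pretzel_phi P * fox pretzel_phi j [(2, False)])"
    by (simp only: fox_append U V)
  also have "\<dots> = u' * ((X - 1) * fox pretzel_phi j Q + fox pretzel_phi j [(1, True)]) +
      X * ((1 - X') * fox pretzel_phi j P + word_val pretzel_phi P * fox pretzel_phi j [(2, False)])"
    by (simp add: fox_word_inv u' algebra_simps del: fox.simps)
  finally show "fox pretzel_phi j (pretzel_rel2 k r m) =
    u' * ((X - 1) * ((\<Sum>i<k. (Y * X) ^ i) * fox pretzel_phi j [(0, True), (1, True)]) +
          fox pretzel_phi j [(1, True)]) +
    X * ((1 - X') * ((\<Sum>i<r - 1. (X * X) ^ i) * fox pretzel_phi j [(2, True), (1, True)]) +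
          (X * X) ^ (r - 1) * fox pretzel_phi j [(2, False)])"
    by (simp only: P_def Q_def fox_word_pow word_val_word_pow word_val_simps lmonom_pretzel_phi mult_1_right)
  have "word_val pretzel_phi Q = (Y * X) ^ k"
    by (simp only: Q_def word_val_word_pow word_val_simps lmonom_pretzel_phi mult_1_right)
  then show "(Y * X) ^ k * u' = 1"
    using word_val_word_inv[of pretzel_phi Q] by (simp add: u' mult.commute)
qed

lemma fox_letters:
  "fox pretzel_phi 0 [(2, True), (1, True)] = 0" "fox pretzel_phi 1 [(2, True), (1, True)] = X"
  "fox pretzel_phi 2 [(2, True), (1, True)] = 1"
  "fox pretzel_phi 0 [(0, True), (2, False)] = 1" "fox pretzel_phi 1 [(0, True), (2, False)] = 0"
  "fox pretzel_phi 2 [(0, True), (2, False)] = - (Y * X')"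
  "fox pretzel_phi 0 [(0, True), (1, True)] = 1" "fox pretzel_phi 1 [(0, True), (1, True)] = Y"
  "fox pretzel_phi 2 [(0, True), (1, True)] = 0"
  "fox pretzel_phi 0 [(1, True)] = 0" "fox pretzel_phi 1 [(1, True)] = 1" "fox pretzel_phi 2 [(1, True)] = 0"
  "fox pretzel_phi 0 [(2, True)] = 0" "fox pretzel_phi 1 [(2, True)] = 0" "fox pretzel_phi 2 [(2, True)] = 1"
  "fox pretzel_phi 0 [(1, False)] = 0" "fox pretzel_phi 1 [(1, False)] = - X'" "fox pretzel_phi 2 [(1, False)] = 0"
  "fox pretzel_phi 0 [(2, False)] = 0" "fox pretzel_phi 1 [(2, False)] = 0" "fox pretzel_phi 2 [(2, False)] = - X'"
  using lmonom_pretzel_phi by simp_all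

text \<open>
  Here $T = \sum_{i<m} (yx^{-1})^i$ is the sum that the Fox derivatives contain; it differs from $H_m$
  by the unit $x^{m-1}$.
\<close>

lemma pretzel_E2_eq:
  assumes "r \<ge> 1" and "m \<ge> 1"
  shows "pretzel_E2 k r m =
    ideal_gen (to_laurent ` {[:A_poly (2 * r - 1):], G_poly k, H_poly m})"
proof -
  define s where "s = r - 1"
  have r: "r = Suc s" and q: "2 * r - 1 = 2 * s + 1"
    using assms by (simp_all add: s_def)
  define u' where "u' = word_val pretzel_phi (word_inv (word_pow [(0, True), (1, True)] k))"
  define G where "G = (\<Sum>i<k. (Y * X) ^ i)"
  define T where "T = (\<Sum>i<m. (Y * X') ^ i)"
  define A where "A = (\<Sum>i<2 * s + 1. (- X) ^ i)"
  define e where "e j w = fox pretzel_phi j w" for j w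
  have "pretzel_E2 k r m = ideal_gen {fox pretzel_phi j w | j w. j < 3 \<and>
      w \<in> set [pretzel_rel1 k r m, pretzel_rel2 k r m]}"
    unfolding pretzel_E2_def by (rule elementary_ideal_entries) simp
  also have "{fox pretzel_phi j w | j w. j < 3 \<and> w \<in> set [pretzel_rel1 k r m, pretzel_rel2 k r m]} =
    {e 0 (pretzel_rel1 k r m), e 1 (pretzel_rel1 k r m), e 2 (pretzel_rel1 k r m),
     e 0 (pretzel_rel2 k r m), e 1 (pretzel_rel2 k r m), e 2 (pretzel_rel2 k r m)}"
  proof -
    have "j < 3 \<longleftrightarrow> j = 0 \<or> j = 1 \<or> j = 2" for j :: nat by auto
    then show ?thesis by (auto simp: e_def)
  qed
  also have "ideal_gen \<dots> = ideal_gen {A, G, T}"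
    unfolding A_def
  proof (rule fox_ideal_generators[OF X_X'])
    show "(Y * X) ^ k * u' = 1"
      unfolding u'_def by (rule fox_pretzel_rel2(2))
    show "(Y * X' - 1) * T = (Y * X') ^ m - 1" "(Y * X - 1) * G = (Y * X) ^ k - 1"
      by (simp_all add: T_def G_def power_diff_1_eq)
  qed (unfold e_def fox_pretzel_rel1 fox_pretzel_rel2(1) u'_def[symmetric] fox_letters G_def[symmetric]
        T_def[symmetric] r, simp_all add: algebra_simps)
  also have "ideal_gen {A, G, T} = ideal_gen (to_laurent ` {[:A_poly (2 * r - 1):], G_poly k, H_poly m})"
  proof -
    have "[:A_poly (2 * r - 1):] = (\<Sum>i<2 * s + 1. (- xR) ^ i)"
      by (simp only: q A_poly_eq[of "2 * s + 1"] odd_two_times_div_two_succ even_plus_one_iff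
          even_mult_iff dvd_refl simp_thms const_poly.hom_sum const_poly.hom_power
          const_poly.hom_uminus xR_def)
    then have *: "to_laurent [:A_poly (2 * r - 1):] = A"
      by (simp only: A_def to_laurent.hom_sum to_laurent.hom_power to_laurent.hom_uminus
          to_laurent_xR X_def)
    have **: "to_laurent (G_poly k) = G"
      by (simp add: G_poly_eq G_def to_laurent.hom_sum to_laurent.hom_power to_laurent.hom_mult
          to_laurent_xR to_laurent_yR X_def Y_def mult.commute)
    define H where "H = to_laurent (H_poly m)"
    have H: "H = (\<Sum>i<m. Y ^ (m - Suc i) * X ^ i)"
      by (simp add: H_def H_poly_eq to_laurent.hom_sum to_laurent.hom_power to_laurent.hom_mult
          to_laurent_xR to_laurent_yR X_def Y_def)
    have "X ^ (m - 1) * T = (\<Sum>i<m. X ^ (m - 1) * (Y * X') ^ i)"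
      by (simp add: T_def sum_distrib_left)
    also have "\<dots> = (\<Sum>i<m. X ^ (m - Suc i) * Y ^ i)"
    proof (intro sum.cong refl)
      fix i assume "i \<in> {..<m}"
      then have "m - 1 = (m - Suc i) + i" by simp
      then have "X ^ (m - 1) * (Y * X') ^ i = X ^ (m - Suc i) * Y ^ i * (X * X') ^ i"
        by (simp add: power_add power_mult_distrib mult_ac)
      then show "X ^ (m - 1) * (Y * X') ^ i = X ^ (m - Suc i) * Y ^ i"
        by (simp add: X_X')
    qed
    also have "\<dots> = H"
      unfolding H by (subst sum.nat_diff_reindex[symmetric]) (auto intro!: sum.cong simp: mult.commute)
    finally have HT: "H = X ^ (m - 1) * T" ..
    have "X' ^ (m - 1) * H = (X * X') ^ (m - 1) * T"
      by (simp add: HT power_mult_distrib mult_ac)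
    then have TH: "T = X' ^ (m - 1) * H"
      by (simp add: X_X')
    have "ideal_gen {A, G, T} = ideal_gen {A, G, H}"
    proof (rule ideal_gen_eqI)
      show "{A, G, T} \<subseteq> ideal_gen {A, G, H}"
        unfolding TH by (auto intro: ideal_gen_base ideal_gen_mult_left)
      show "{A, G, H} \<subseteq> ideal_gen {A, G, T}"
        unfolding HT by (auto intro: ideal_gen_base ideal_gen_mult_left)
    qed
    then show ?thesis
      by (simp only: image_insert image_empty * ** H_def[symmetric])
  qed
  finally show ?thesis .
qed

end

text \<open>
  The contraction lemma applies because $G_k = 1 + xy + \dots + (xy)^{k-1}$ exhibits an inverse of $xy$
  modulo the ideal.
\<close>

theorem pretzel_ideal_eq:
  assumes "k \<ge> 1" and "m \<ge> 1" and "r \<ge> 1"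
  shows "pretzel_ideal k r m = ideal_gen {[:A_poly (2 * r - 1):], G_poly k, H_poly m}"
proof -
  define w where "w = - (\<Sum>i<k - 1. (xR * yR) ^ i)"
  let ?S = "{[:A_poly (2 * r - 1):], G_poly k, H_poly m}"
  have "G_poly k = 1 - xR * yR * w"
    using assms(1) sum.lessThan_Suc_shift[of "\<lambda>i. (xR * yR) ^ i" "k - 1"]
    by (simp add: G_poly_eq w_def sum_distrib_left)
  then have "ideal_cong ?S 1 (xR * yR * w)"
    unfolding ideal_cong_def by (auto intro: ideal_gen_base)
  then have unit: "ideal_cong ?S (xR * yR * w) 1"
    by (rule ideal_cong_sym)
  have "p \<in> pretzel_ideal k r m \<longleftrightarrow> p \<in> ideal_gen ?S" for p
    unfolding pretzel_ideal_def mem_Collect_eq pretzel_E2_eq[OF assms(3,2)]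
    by (rule laurent_ideal_contraction[OF _ unit]) simp
  then show ?thesis by blast
qed

section \<open>Elimination of the variable $y$\<close>

lemma G_poly_mult: "(1 - xR * yR) * G_poly k = 1 - (xR * yR) ^ k"
  by (simp add: G_poly_eq one_diff_power_eq)

lemma H_poly_mult: "(xR - yR) * H_poly m = xR ^ m - yR ^ m"
  by (simp add: H_poly_eq power_diff_sumr2)

lemma ideal_cong_const:
  fixes f g P :: "rat poly"
  assumes "[f = g] (mod P)" and "[:P:] \<in> ideal_gen S"
  shows "ideal_cong S [:f:] [:g:]"
proof -
  from assms(1) have "P dvd f - g"
    by (simp add: cong_iff_dvd_diff)
  then have "[:P:] dvd [:f:] - [:g:]"
    by (metis const_poly.hom_dvd const_poly.hom_minus)
  with assms(2) show ?thesis
    unfolding ideal_cong_def by (rule ideal_gen_dvd)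
qed

text \<open>
  Modulo $G_k$ and $H_m$ one has $(xy)^k = 1$ and $x^m = y^m$, hence formally
  $y = y^{um} y^{vk} = x^{um} x^{-vk} = x^e$. The proof splits on the sign of \<open>v\<close> in order to avoid negative
  powers. With $a = |u|$ and $b = |v|$, for $v \le 0$ it multiplies $y$ by $(xy)^{bk} = 1$ and uses
  $y^{1+bk} = y^{am} = x^{am}$; for $v > 0$ it shows $y\, x^{am+bk} = 1$ from $x^{am} = y^{am}$ and
  $(xy)^{bk} = 1$.
\<close>

lemma yR_cong_x_powi:
  assumes S: "[:P:] \<in> ideal_gen S" "G_poly k \<in> ideal_gen S" "H_poly m \<in> ideal_gen S"
    and km: "k \<ge> 1" "m \<ge> 1"
    and uv: "u * int m + v * int k = 1" and e: "e = u * int m - v * int k"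
    and E: "cong_x_powi P E e"
  shows "ideal_cong S yR [:E:]"
proof -
  have G: "ideal_cong S ((xR * yR) ^ k) 1"
  proof (rule ideal_cong_sym)
    show "ideal_cong S 1 ((xR * yR) ^ k)"
      using ideal_gen_mult_left[OF S(2), of "1 - xR * yR"] by (simp add: ideal_cong_def G_poly_mult)
  qed
  have H: "ideal_cong S (xR ^ m) (yR ^ m)"
    using ideal_gen_mult_left[OF S(3), of "xR - yR"] by (simp add: ideal_cong_def H_poly_mult)
  have xR_power: "xR ^ n = [:[:0, 1:] ^ n:]" for n
    by (simp add: xR_def const_poly.hom_power)
  show ?thesis
  proof (cases "v \<le> 0")
    case True
    define b where "b = nat (- v)"
    have v: "v = - int b" using True by (simp add: b_def)
    have "u * int m > 0" using uv km True by (simp add: v algebra_simps) (smt (verit) mult_nonneg_nonneg of_nat_0_le_iff)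
    then have "u > 0" using km by (simp add: zero_less_mult_iff)
    define a where "a = nat u"
    have u: "u = int a" using \<open>u > 0\<close> by (simp add: a_def)
    have "int (a * m) = int (1 + b * k)" using uv by (simp add: u v)
    then have am: "a * m = 1 + b * k" by (simp only: of_nat_eq_iff)
    have e': "e = int (a * m + b * k)" by (simp add: e u v)
    have "ideal_cong S (yR * 1 ^ b) (yR * ((xR * yR) ^ k) ^ b)"
      by (intro ideal_cong_mult ideal_cong_power ideal_cong_refl ideal_cong_sym[OF G])
    also have "yR * ((xR * yR) ^ k) ^ b = (yR ^ m) ^ a * xR ^ (b * k)"
      using am by (simp add: power_mult_distrib mult_ac flip: power_mult power_Suc)
    also have "ideal_cong S \<dots> ((xR ^ m) ^ a * xR ^ (b * k))"
      by (intro ideal_cong_mult ideal_cong_power ideal_cong_refl ideal_cong_sym[OF H])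
    also have "(xR ^ m) ^ a * xR ^ (b * k) = xR ^ (a * m + b * k)"
      by (simp add: power_add mult.commute flip: power_mult)
    also have "ideal_cong S \<dots> [:E:]"
    proof -
      have "[E = [:0, 1:] ^ (a * m + b * k)] (mod P)"
        using E unfolding e' cong_x_powi_def by (simp only: of_nat_0_le_iff if_True nat_int)
      then show ?thesis
        unfolding xR_power by (intro ideal_cong_const[OF cong_sym S(1)])
    qed
    finally show ?thesis by simp
  next
    case False
    define b where "b = nat v"
    have v: "v = int b" "b > 0" using False by (simp_all add: b_def)
    have "int b * int k > 0" using v km by simp
    then have "int b * int k \<ge> 1" by linarith
    then have "u * int m \<le> 0" using uv by (simp add: v)
    then have "u \<le> 0" using km by (simp add: mult_le_0_iff)
    define a where "a = nat (- u)"
    have u: "u = - int a" using \<open>u \<le> 0\<close> by (simp add: a_def)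
    have "int (b * k) = int (1 + a * m)" using uv by (simp add: u v)
    then have bk: "b * k = 1 + a * m" by (simp only: of_nat_eq_iff)
    have e': "e = - int (a * m + b * k)" "a * m + b * k > 0"
      by (simp add: e u v) (use bk in simp)
    have inv: "ideal_cong S ([:E:] * xR ^ (a * m + b * k)) 1"
    proof -
      have "[E * [:0, 1:] ^ (a * m + b * k) = 1] (mod P)"
      proof -
        have "\<not> (0 \<le> - int (a * m + b * k))" using e'(2) by linarith
        then show ?thesis
          using E by (simp only: e'(1) cong_x_powi_def if_False minus_minus nat_int)
      qed
      from ideal_cong_const[OF this S(1)] show ?thesis
        by (simp only: const_poly.hom_mult const_poly.hom_one xR_power)
    qed
    have "ideal_cong S (yR * 1) (yR * ([:E:] * xR ^ (a * m + b * k)))"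
      by (intro ideal_cong_mult ideal_cong_refl ideal_cong_sym[OF inv])
    also have "yR * ([:E:] * xR ^ (a * m + b * k)) = [:E:] * ((xR ^ m) ^ a * (yR * xR ^ (b * k)))"
      by (simp add: power_add mult_ac flip: power_mult)
    also have "ideal_cong S \<dots> ([:E:] * ((yR ^ m) ^ a * (yR * xR ^ (b * k))))"
      by (intro ideal_cong_mult ideal_cong_power ideal_cong_refl H)
    also have "(yR ^ m) ^ a * (yR * xR ^ (b * k)) = ((xR * yR) ^ k) ^ b"
      using bk by (simp add: power_mult_distrib mult_ac flip: power_mult power_Suc)
    also have "ideal_cong S ([:E:] * ((xR * yR) ^ k) ^ b) ([:E:] * 1 ^ b)"
      by (intro ideal_cong_mult ideal_cong_power ideal_cong_refl G)
    finally show ?thesis by simp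
  qed
qed

lemma ideal_cong_poly_eval:
  assumes "ideal_cong S yR [:E:]"
  shows "ideal_cong S f [:poly f E:]"
proof -
  have "poly (f - [:poly f E:]) E = 0" by simp
  then have "[:- E, 1:] dvd f - [:poly f E:]"
    by (simp only: poly_eq_0_iff_dvd)
  moreover have "[:- E, 1:] \<in> ideal_gen S"
    using assms by (simp add: ideal_cong_def yR_def)
  ultimately show ?thesis
    unfolding ideal_cong_def by (rule ideal_gen_dvd[rotated])
qed

text \<open>
  Modulo $y - E$ every polynomial in $x$ and $y$ equals its value at $y = E$, and polynomials in $x$ alone
  generate the same ideal as their gcd.
\<close>

lemma ideal_gen_eliminate_y:
  fixes P :: "rat poly" and f g :: biv
  assumes "ideal_cong {[:P:], f, g} yR [:E:]"
  shows "ideal_gen {[:P:], f, g} =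
    ideal_gen {[:gcd P (gcd (poly f E) (poly g E)):], yR - [:E:]}"
proof -
  define d where "d = gcd P (gcd (poly f E) (poly g E))"
  define S where "S = {[:P:], f, g}"
  define T where "T = {[:d:], yR - [:E:]}"
  have S: "[:P:] \<in> ideal_gen S" "f \<in> ideal_gen S" "g \<in> ideal_gen S"
    and T: "[:d:] \<in> ideal_gen T" "yR - [:E:] \<in> ideal_gen T"
    by (auto simp: S_def T_def intro: ideal_gen_base)
  have ST: "[:c:] \<in> ideal_gen T" if "d dvd c" for c
    using T(1) that const_poly.hom_dvd[of d c] by (auto intro: ideal_gen_dvd)
  have yT: "ideal_cong T yR [:E:]" and yS: "ideal_cong S yR [:E:]"
    using T assms by (simp_all add: ideal_cong_def S_def)
  have "d dvd P" "d dvd poly f E" "d dvd poly g E"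
    unfolding d_def by (auto intro: dvd_trans[OF gcd_dvd2])
  then have "[:P:] \<in> ideal_gen T" "f \<in> ideal_gen T" "g \<in> ideal_gen T"
    unfolding ideal_cong_mem_iff[OF ideal_cong_poly_eval[OF yT], of f] ideal_cong_mem_iff[OF ideal_cong_poly_eval[OF yT], of g]
    by (simp_all add: ST)
  then have "S \<subseteq> ideal_gen T"
    by (simp add: S_def)
  moreover have gcd_S: "[:gcd a b:] \<in> ideal_gen S"
    if "[:a:] \<in> ideal_gen S" "[:b:] \<in> ideal_gen S" for a b
  proof -
    obtain a' b' where "gcd a b = a' * a + b' * b"
      by (metis bezout_coefficients_fst_snd)
    then have "[:gcd a b:] = [:a':] * [:a:] + [:b':] * [:b:]"
      by simp
    then show ?thesis
      using that by (metis ideal_gen_add ideal_gen_mult_left)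
  qed
  have "T \<subseteq> ideal_gen S"
    using S ideal_cong_mem_iff[OF ideal_cong_poly_eval[OF yS]] yS
    unfolding T_def d_def ideal_cong_def by (auto intro!: gcd_S)
  ultimately show ?thesis
    unfolding S_def T_def d_def by (rule ideal_gen_eqI)
qed

lemma cong_x_powi_exists:
  assumes "coprime [:0, 1:] P"
  shows "\<exists>f. cong_x_powi P f e"
proof (cases "e \<ge> 0")
  case True
  then have "cong_x_powi P ([:0, 1:] ^ nat e) e"
    by (simp add: cong_x_powi_def)
  then show ?thesis ..
next
  case False
  obtain i c where "i * [:0, 1:] + c * P = 1"
    using assms by (metis bezout_coefficients_fst_snd coprime_imp_gcd_eq_1)
  then have "1 - i * [:0, 1:] = c * P"
    by (metis add_diff_cancel_left')
  then have "[i * [:0, 1:] = 1] (mod P)"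
    by (intro cong_sym[of 1]) (metis cong_iff_dvd_diff dvd_triv_right)
  then have "[(i * [:0, 1:]) ^ nat (- e) = 1 ^ nat (- e)] (mod P)"
    by (rule cong_pow)
  then have "cong_x_powi P (i ^ nat (- e)) e"
    using False by (simp only: cong_x_powi_def power_mult_distrib power_one if_False)
  then show ?thesis ..
qed

text \<open>
  A negative exponent determines the residue class because the power of $x$ can be cancelled.
\<close>

lemma cong_x_powi_unique:
  assumes "coprime [:0, 1:] P" "cong_x_powi P f e" "cong_x_powi P g e"
  shows "[f = g] (mod P)"
proof (cases "e \<ge> 0")
  case True
  with assms show ?thesis
    by (auto simp: cong_x_powi_def intro: cong_trans cong_sym)
next
  case False
  with assms(2,3) have "[f * [:0, 1:] ^ nat (- e) = g * [:0, 1:] ^ nat (- e)] (mod P)"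
    by (auto simp: cong_x_powi_def intro: cong_trans cong_sym)
  then have "P dvd (f - g) * [:0, 1:] ^ nat (- e)"
    by (simp add: cong_iff_dvd_diff algebra_simps)
  moreover have "coprime P ([:0, 1:] ^ nat (- e))"
    using assms(1) by (simp add: coprime_commute)
  ultimately have "P dvd f - g"
    using coprime_dvd_mult_left_iff by blast
  then show ?thesis
    by (simp add: cong_iff_dvd_diff)
qed

lemma cong_x_powi_dvd: "cong_x_powi P f e \<Longrightarrow> Q dvd P \<Longrightarrow> cong_x_powi Q f e"
  by (auto simp: cong_x_powi_def intro: cong_dvd_modulus)

lemma cong_x_powi_cong:
  assumes "cong_x_powi P f e" "[f = g] (mod P)"
  shows "cong_x_powi P g e"
proof -
  have "[g * c = f * c] (mod P)" for c
    using assms(2) by (intro cong_mult cong_refl) (rule cong_sym)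
  with assms show ?thesis
    unfolding cong_x_powi_def by (metis cong_sym cong_trans)
qed

section \<open>Rational polynomials with simple complex roots\<close>

definition cpoly :: "rat poly \<Rightarrow> complex poly" where
  "cpoly = map_poly of_rat"

interpretation cpoly: inj_idom_hom cpoly
proof -
  interpret map_poly_inj_idom_hom "of_rat :: rat \<Rightarrow> complex" ..
  show "inj_idom_hom cpoly"
    unfolding cpoly_def ..
qed

lemma cpoly_dvd_iff: "cpoly p dvd cpoly q \<longleftrightarrow> p dvd q"
  unfolding cpoly_def
  by (metis cpoly.hom_dvd cpoly_def of_rat_hom.dvd_map_poly_hom_imp_dvd)

lemma degree_cpoly [simp]: "degree (cpoly p) = degree p"
  by (simp add: cpoly_def)

lemma lead_coeff_cpoly: "lead_coeff (cpoly p) = of_rat (lead_coeff p)"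
  by (simp add: cpoly_def)

lemma cpoly_pCons [simp]: "cpoly (pCons a p) = pCons (of_rat a) (cpoly p)"
  by (simp add: cpoly_def of_rat_hom.map_poly_pCons_hom)

definition linear_product :: "complex set \<Rightarrow> complex poly" where
  "linear_product Z = (\<Prod>z\<in>Z. [:- z, 1:])"

lemma lead_coeff_linear_product: "lead_coeff (linear_product Z) = 1"
  by (simp add: linear_product_def lead_coeff_prod)

lemma poly_linear_product_eq_0_iff: "finite Z \<Longrightarrow> poly (linear_product Z) z = 0 \<longleftrightarrow> z \<in> Z"
  by (auto simp: linear_product_def poly_prod)

lemma rsquarefree_dvd:
  fixes p :: "'a::field_char_0 poly"
  assumes "rsquarefree p" "d dvd p"
  shows "rsquarefree d"
proof -
  from assms(2) obtain c where "p = d * c" ..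
  with assms(1) show ?thesis
    by (auto simp: rsquarefree_roots pderiv_mult)
qed

lemma linear_product_rsquarefree:
  assumes "rsquarefree p" "lead_coeff p = 1"
  shows "p = linear_product {z. poly p z = 0}"
  using complex_poly_decompose_rsquarefree[OF assms(1)] assms(2)
  by (simp add: linear_product_def)

text \<open>
  A gcd with a polynomial \<open>P\<close> whose complex roots are simple has simple roots too, so it is determined by
  the set of common roots. All gcds in $\mathbb{Q}[x]$ below are computed in this way.
\<close>

lemma gcd_eq_linear_product:
  assumes sq: "rsquarefree (cpoly P)"
    and Q: "cpoly Q = linear_product
      {z. poly (cpoly P) z = 0 \<and> poly (cpoly f) z = 0 \<and> poly (cpoly g) z = 0}"
  shows "gcd P (gcd f g) = Q"
proof -
  define d where "d = gcd P (gcd f g)"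
  have "P \<noteq> 0"
    using sq by (auto simp: rsquarefree_def)
  then have "lead_coeff d = 1"
    unfolding d_def by (intro poly_gcd_monic disjI1)
  then have lc: "lead_coeff (cpoly d) = 1"
    unfolding lead_coeff_cpoly by simp
  have "rsquarefree (cpoly d)"
    using sq by (rule rsquarefree_dvd) (simp add: cpoly_dvd_iff d_def)
  then have "cpoly d = linear_product {z. poly (cpoly d) z = 0}"
    using lc by (rule linear_product_rsquarefree)
  moreover have "poly (cpoly d) z = 0 \<longleftrightarrow>
      poly (cpoly P) z = 0 \<and> poly (cpoly f) z = 0 \<and> poly (cpoly g) z = 0" for z
  proof
    assume "poly (cpoly d) z = 0"
    moreover have "d dvd P" "d dvd f" "d dvd g"
      by (auto simp: d_def intro: dvd_trans[OF gcd_dvd2])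
    then have "cpoly d dvd cpoly P" "cpoly d dvd cpoly f" "cpoly d dvd cpoly g"
      by (simp_all add: cpoly_dvd_iff)
    ultimately show "poly (cpoly P) z = 0 \<and> poly (cpoly f) z = 0 \<and> poly (cpoly g) z = 0"
      by (auto elim!: dvdE)
  next
    assume z: "poly (cpoly P) z = 0 \<and> poly (cpoly f) z = 0 \<and> poly (cpoly g) z = 0"
    have bezout: "\<exists>a b. gcd p q = a * p + b * q" for p q :: "rat poly"
      by (metis bezout_coefficients_fst_snd)
    obtain a b where ab: "gcd f g = a * f + b * g"
      using bezout by blast
    obtain a' b' where "d = a' * P + b' * gcd f g"
      unfolding d_def using bezout by blast
    with ab z show "poly (cpoly d) z = 0"
      by (simp add: cpoly.hom_add cpoly.hom_mult)
  qed
  ultimately have "cpoly d = cpoly Q"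
    by (simp add: Q)
  then show ?thesis
    by (simp add: d_def)
qed

section \<open>Roots of unity and cyclotomic polynomials\<close>

definition primitive_roots :: "nat \<Rightarrow> complex set" where
  "primitive_roots n = {z. z ^ n = 1 \<and> (\<forall>i. 0 < i \<and> i < n \<longrightarrow> z ^ i \<noteq> 1)}"

lemma primitive_roots_power_eq_1_iff:
  assumes "z \<in> primitive_roots n" "n > 0"
  shows "z ^ j = 1 \<longleftrightarrow> n dvd j"
proof -
  have "z ^ j = (z ^ n) ^ (j div n) * z ^ (j mod n)"
    by (simp flip: power_mult power_add)
  also have "\<dots> = z ^ (j mod n)"
    using assms by (simp add: primitive_roots_def)
  finally have "z ^ j = 1 \<longleftrightarrow> z ^ (j mod n) = 1" by simp
  also have "\<dots> \<longleftrightarrow> j mod n = 0"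
    using assms by (auto simp: primitive_roots_def dest: spec[of _ "j mod n"])
  finally show ?thesis by (simp add: dvd_eq_mod_eq_0)
qed

lemma primitive_roots_nonzero: "z \<in> primitive_roots n \<Longrightarrow> n > 0 \<Longrightarrow> z \<noteq> 0"
  by (auto simp: primitive_roots_def power_0_left split: if_splits)

lemma primitive_roots_powi_eq_1_iff:
  assumes "z \<in> primitive_roots n" "n > 0"
  shows "z powi j = 1 \<longleftrightarrow> int n dvd j"
proof (cases "j \<ge> 0")
  case True
  then obtain i where "j = int i" using nonneg_int_cases by blast
  then show ?thesis using primitive_roots_power_eq_1_iff[OF assms, of i] by simp
next
  case False
  then obtain i where "j = - int i" by (metis nonpos_int_cases nle_le)
  then show ?thesis using primitive_roots_power_eq_1_iff[OF assms, of i] by (simp add: power_int_minus)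
qed

lemma root_of_unity_order:
  assumes "z ^ n = (1::complex)" "n > 0"
  obtains d where "d > 0" "d dvd n" "z \<in> primitive_roots d"
proof -
  define d where "d = (LEAST i. i > 0 \<and> z ^ i = 1)"
  have d: "d > 0 \<and> z ^ d = 1"
    unfolding d_def by (rule LeastI[of _ n]) (use assms in simp)
  have "z ^ i \<noteq> 1" if "0 < i" "i < d" for i
    using not_less_Least[of i "\<lambda>i. i > 0 \<and> z ^ i = 1"] that by (simp add: d_def)
  with d have "z \<in> primitive_roots d"
    by (simp add: primitive_roots_def)
  moreover from this have "d dvd n"
    using assms d primitive_roots_power_eq_1_iff by blast
  ultimately show ?thesis
    using d that by blast
qed

lemma primitive_roots_disjoint:
  assumes "z \<in> primitive_roots a" "z \<in> primitive_roots b" "a > 0" "b > 0"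
  shows "a = b"
  using assms primitive_roots_power_eq_1_iff by (metis dvd_antisym dvd_refl)

lemma finite_primitive_roots: "n > 0 \<Longrightarrow> finite (primitive_roots n)"
  unfolding primitive_roots_def by (rule finite_subset[OF _ finite_nth_roots[of n 1]]) auto

lemma primitive_roots_nonempty:
  assumes "n > 0"
  shows "primitive_roots n \<noteq> {}"
proof -
  have "cis (2 * pi / n) ^ i \<noteq> 1" if "0 < i" "i < n" for i
  proof -
    have "inj_on (\<lambda>k. cis (2 * pi * real k / real n)) {..<n}"
      using bij_betw_roots_unity[OF assms] by (simp add: bij_betw_def)
    then have "cis (2 * pi * real i / real n) \<noteq> cis (2 * pi * real 0 / real n)"
      using that assms by (metis inj_on_contraD lessThan_iff less_numeral_extra(3))
    then show ?thesis
      by (simp add: DeMoivre mult_ac)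
  qed
  moreover have "cis (2 * pi / n) ^ n = 1"
    using assms by (simp add: DeMoivre)
  ultimately show ?thesis
    by (auto simp: primitive_roots_def)
qed

lemma rsquarefree_power_minus_const:
  assumes "n > 0" "c \<noteq> 0"
  shows "rsquarefree ([:0, 1:] ^ n - [:c:] :: complex poly)"
  using assms by (auto simp: rsquarefree_roots pderiv_diff pderiv_power pderiv_pCons power_0_left)

lemma linear_product_UN:
  assumes "finite I" "\<And>i. i \<in> I \<Longrightarrow> finite (Z i)"
    "\<And>i j. i \<in> I \<Longrightarrow> j \<in> I \<Longrightarrow> i \<noteq> j \<Longrightarrow> Z i \<inter> Z j = {}"
  shows "linear_product (\<Union>i\<in>I. Z i) = (\<Prod>i\<in>I. linear_product (Z i))"
  unfolding linear_product_def using assms by (intro prod.UNION_disjoint) auto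

lemma lead_coeff_power_minus_const:
  fixes c :: "'a::idom"
  assumes "n > 0"
  shows "lead_coeff ([:0, 1:] ^ n - [:c:]) = 1"
proof -
  have eq: "[:0, 1:] ^ n - [:c:] = monom 1 n + [:- c:]"
    by (simp add: monom_altdef)
  have "degree (monom 1 n + [:- c:]) = n"
    using assms by (subst degree_add_eq_left) (simp_all add: degree_monom_eq)
  moreover have "coeff (monom 1 n + [:- c:]) n = 1"
    using assms by (simp add: coeff_eq_0)
  ultimately show ?thesis
    unfolding eq by simp
qed

lemma cpoly_power_minus_1: "n > 0 \<Longrightarrow> cpoly ([:0, 1:] ^ n - 1) = linear_product {z. z ^ n = 1}"
proof -
  assume n: "n > 0"
  have "cpoly ([:0, 1:] ^ n - 1) = [:0, 1:] ^ n - [:1:]"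
    by (simp add: cpoly.hom_minus cpoly.hom_power)
  also have "\<dots> = linear_product {z. poly ([:0, 1:] ^ n - [:1:]) z = 0}"
    using n by (intro linear_product_rsquarefree rsquarefree_power_minus_const
        lead_coeff_power_minus_const) simp_all
  finally show ?thesis by simp
qed

text \<open>
  By induction on \<open>n\<close>: the product over the proper divisors of \<open>n\<close> is rational and divides $x^n - 1$ over
  $\mathbb{C}$, hence over $\mathbb{Q}$, and the rational quotient is the polynomial of the primitive
  \<open>n\<close>-th roots.
\<close>

lemma primitive_linear_product_rational:
  assumes "n > 0"
  shows "\<exists>p. cpoly p = linear_product (primitive_roots n)"
  using assms
proof (induction n rule: less_induct)
  case (less n)
  let ?D = "{d. d dvd n \<and> d < n}"
  have D: "d > 0" if "d \<in> ?D" for d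
    using that less.prems by (auto intro: Nat.gr0I)
  have "\<forall>d\<in>?D. \<exists>p. cpoly p = linear_product (primitive_roots d)"
    using less.IH D by blast
  then obtain p where p: "\<And>d. d \<in> ?D \<Longrightarrow> cpoly (p d) = linear_product (primitive_roots d)"
    by metis
  have "{z. z ^ n = 1} = (\<Union>d\<in>insert n ?D. primitive_roots d)"
  proof (intro equalityI subsetI)
    fix z :: complex assume "z \<in> {z. z ^ n = 1}"
    then obtain d where "d dvd n" "z \<in> primitive_roots d"
      using root_of_unity_order[of z n] less.prems by auto
    moreover have "d \<le> n"
      using \<open>d dvd n\<close> less.prems by (simp add: dvd_imp_le)
    ultimately show "z \<in> (\<Union>d\<in>insert n ?D. primitive_roots d)"
      by (cases "d = n") auto
  next
    fix z assume "z \<in> (\<Union>d\<in>insert n ?D. primitive_roots d)"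
    then obtain d where "d \<in> insert n ?D" "z \<in> primitive_roots d"
      by blast
    moreover from this have "d dvd n" "d > 0"
      using D less.prems by auto
    ultimately show "z \<in> {z. z ^ n = 1}"
      by (simp add: primitive_roots_power_eq_1_iff)
  qed
  then have "cpoly ([:0, 1:] ^ n - 1) = linear_product (\<Union>d\<in>insert n ?D. primitive_roots d)"
    using cpoly_power_minus_1[OF less.prems] by simp
  also have "\<dots> = (\<Prod>d\<in>insert n ?D. linear_product (primitive_roots d))"
  proof (rule linear_product_UN)
    show "finite (insert n ?D)" by simp
    show "finite (primitive_roots d)" if "d \<in> insert n ?D" for d
      using that D less.prems by (auto intro: finite_primitive_roots)
    show "primitive_roots a \<inter> primitive_roots b = {}"
      if "a \<in> insert n ?D" "b \<in> insert n ?D" "a \<noteq> b" for a b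
      using that D less.prems primitive_roots_disjoint[of _ a b] by blast
  qed
  also have "\<dots> = linear_product (primitive_roots n) * cpoly (\<Prod>d\<in>?D. p d)"
    by (simp add: p cpoly.hom_prod)
  finally have *: "cpoly ([:0, 1:] ^ n - 1) = linear_product (primitive_roots n) * cpoly (\<Prod>d\<in>?D. p d)" .
  then have "(\<Prod>d\<in>?D. p d) dvd [:0, 1:] ^ n - 1"
    by (simp add: cpoly_dvd_iff[symmetric] del: cpoly.hom_prod)
  then obtain c where c: "[:0, 1:] ^ n - 1 = (\<Prod>d\<in>?D. p d) * c" ..
  have "cpoly ([:0, 1:] ^ n - 1) \<noteq> 0"
    using cpoly_power_minus_1[OF less.prems] lead_coeff_linear_product[of "{z. z ^ n = 1}"]
    by (metis leading_coeff_0_iff zero_neq_one)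
  then have "cpoly c = linear_product (primitive_roots n)"
    using * unfolding c cpoly.hom_mult by (simp add: mult.commute)
  then show ?case ..
qed

text \<open>
  The definite description in the definition of \<open>cyclotomic\<close> denotes, because the product over the
  primitive roots has rational coefficients.
\<close>

lemma cpoly_cyclotomic: "n > 0 \<Longrightarrow> cpoly (cyclotomic n) = linear_product (primitive_roots n)"
proof -
  assume "n > 0"
  then obtain p where p: "cpoly p = linear_product (primitive_roots n)"
    using primitive_linear_product_rational by blast
  have "cyclotomic n = (THE p. cpoly p = linear_product (primitive_roots n))"
    unfolding cyclotomic_def cpoly_def linear_product_def primitive_roots_def ..
  also have "\<dots> = p"
    using p by (intro the_equality) (metis cpoly.eq_iff)+
  finally show ?thesis
    using p by simp
qed

lemma lead_coeff_cyclotomic: "n > 0 \<Longrightarrow> lead_coeff (cyclotomic n) = 1"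
  using lead_coeff_cpoly[of "cyclotomic n"] lead_coeff_linear_product[of "primitive_roots n"]
  by (simp add: cpoly_cyclotomic)

lemma degree_cyclotomic_pos:
  assumes "n > 0"
  shows "degree (cyclotomic n) > 0"
proof (rule ccontr)
  assume "\<not> degree (cyclotomic n) > 0"
  then obtain c where c: "cpoly (cyclotomic n) = [:c:]"
    by (metis degree_cpoly degree_eq_zeroE neq0_conv)
  obtain z where "z \<in> primitive_roots n"
    using primitive_roots_nonempty[OF assms] by blast
  then have "poly (cpoly (cyclotomic n)) z = 0"
    using assms by (simp add: cpoly_cyclotomic poly_linear_product_eq_0_iff finite_primitive_roots)
  then have "c = 0" by (simp add: c)
  then show False
    using lead_coeff_linear_product[of "primitive_roots n"] c assms
    by (simp add: cpoly_cyclotomic)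
qed

lemma finite_linear_product_rsquarefree: "finite Z \<Longrightarrow> rsquarefree (linear_product Z)"
  unfolding rsquarefree_roots
proof (intro allI notI)
  fix a assume Z: "finite Z" and a: "poly (linear_product Z) a = 0 \<and> poly (pderiv (linear_product Z)) a = 0"
  then have aZ: "a \<in> Z" by (simp add: poly_linear_product_eq_0_iff)
  have "linear_product Z = [:- a, 1:] * linear_product (Z - {a})"
    unfolding linear_product_def by (rule prod.remove[OF Z aZ])
  then have "pderiv (linear_product Z) =
      [:- a, 1:] * pderiv (linear_product (Z - {a})) + linear_product (Z - {a})"
    by (simp only: pderiv_mult) (simp add: pderiv_pCons)
  then have "poly (linear_product (Z - {a})) a = 0"
    using a by simp
  then show False
    using Z by (simp add: poly_linear_product_eq_0_iff)
qed

lemma A_poly_mult: "odd q \<Longrightarrow> (1 + [:0, 1:]) * A_poly q = 1 + [:0, 1:] ^ q"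
  using one_diff_power_eq[of "- [:0, 1:] :: rat poly" q] power_minus_odd[of q "[:0, 1:] :: rat poly"]
  by (metis A_poly_eq diff_minus_eq_add)

text \<open>
  $A_q$ divides $x^q + 1$, which has no common root with its derivative.
\<close>

lemma rsquarefree_A_poly:
  assumes "odd q"
  shows "rsquarefree (cpoly (A_poly q))"
proof -
  have "q > 0" using assms by (simp add: odd_pos)
  have "cpoly ((1 + [:0, 1:]) * A_poly q) = [:0, 1:] ^ q - [:-1:]"
    unfolding A_poly_mult[OF assms] by (simp add: cpoly.hom_add cpoly.hom_power)
  moreover have "rsquarefree ([:0, 1:] ^ q - [:-1:] :: complex poly)"
    using \<open>q > 0\<close> by (rule rsquarefree_power_minus_const) simp
  ultimately show ?thesis
    by (metis cpoly.hom_mult dvd_triv_right rsquarefree_dvd)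
qed

text \<open>
  For odd \<open>q\<close>, the roots of $A_q$ are the $z \neq -1$ with $z^q = -1$. The order of such a \<open>z\<close> divides $2q$
  but not \<open>q\<close>, so it is $2\delta$ with $\delta \mid q$, and $\delta = 1$ would mean $z = -1$. Conversely,
  $z^q$ is a square root of $1$ other than $1$ if the order of \<open>z\<close> is even and divides $2q$.
\<close>

lemma A_poly_root_iff:
  assumes "odd q"
  shows "poly (cpoly (A_poly q)) z = 0 \<longleftrightarrow> z \<in> (\<Union>\<delta>\<in>{\<delta>. \<delta> > 1 \<and> \<delta> dvd q}. primitive_roots (2 * \<delta>))"
proof -
  have q: "q > 0" using assms by (simp add: odd_pos)
  have "poly (cpoly ((1 + [:0, 1:]) * A_poly q)) z = 1 + z ^ q"
    unfolding A_poly_mult[OF assms] by (simp add: cpoly.hom_add cpoly.hom_power)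
  then have mult: "(1 + z) * poly (cpoly (A_poly q)) z = 1 + z ^ q"
    by (simp add: cpoly.hom_mult cpoly.hom_add)
  have "poly (cpoly (A_poly q)) (-1) = of_nat q"
    using assms by (simp add: A_poly_eq cpoly.hom_sum cpoly.hom_power cpoly.hom_uminus poly_sum)
  then have "poly (cpoly (A_poly q)) z = 0 \<longleftrightarrow> z ^ q = -1 \<and> z \<noteq> -1"
    using mult q by (cases "z = -1") (auto simp: add_eq_0_iff)
  also have "\<dots> \<longleftrightarrow> z \<in> (\<Union>\<delta>\<in>{\<delta>. \<delta> > 1 \<and> \<delta> dvd q}. primitive_roots (2 * \<delta>))"
  proof
    assume z: "z ^ q = -1 \<and> z \<noteq> -1"
    then have "z ^ (q * 2) = 1"
      unfolding power_mult by simp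
    then obtain n where n: "n > 0" "n dvd q * 2" "z \<in> primitive_roots n"
      using root_of_unity_order[of z "q * 2"] q by auto
    have "\<not> n dvd q"
      using z n primitive_roots_power_eq_1_iff[of z n q] by simp
    then have "even n"
      using n(2) by (metis coprime_dvd_mult_left_iff coprime_right_2_iff_odd)
    then obtain \<delta> where \<delta>: "n = 2 * \<delta>" by blast
    with n have "\<delta> dvd q" by (simp add: mult.commute[of q])
    moreover have "\<delta> \<noteq> 1"
    proof
      assume "\<delta> = 1"
      then have "z ^ 2 = 1" "z ^ 1 \<noteq> 1"
        using n \<delta> by (auto simp: primitive_roots_def)
      with z show False by (simp add: power2_eq_1_iff)
    qed
    moreover have "\<delta> > 0" using n \<delta> by simp
    ultimately show "z \<in> (\<Union>\<delta>\<in>{\<delta>. \<delta> > 1 \<and> \<delta> dvd q}. primitive_roots (2 * \<delta>))"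
      using n(3) by (intro UN_I[of \<delta>]) (simp_all add: \<delta>)
  next
    assume "z \<in> (\<Union>\<delta>\<in>{\<delta>. \<delta> > 1 \<and> \<delta> dvd q}. primitive_roots (2 * \<delta>))"
    then obtain \<delta> where \<delta>: "\<delta> > 1" "\<delta> dvd q" "z \<in> primitive_roots (2 * \<delta>)" by auto
    then have order: "z ^ j = 1 \<longleftrightarrow> 2 * \<delta> dvd j" for j
      using primitive_roots_power_eq_1_iff[of z "2 * \<delta>"] by simp
    have "(z ^ q)\<^sup>2 = z ^ (2 * q)"
      by (simp add: mult.commute flip: power_mult)
    then have "(z ^ q)\<^sup>2 = 1"
      using order \<delta>(2) by simp
    moreover have "z ^ q \<noteq> 1"
      using order assms by (metis dvd_mult_left)
    ultimately have "z ^ q = -1"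
      by (simp add: power2_eq_1_iff)
    moreover have "z \<noteq> -1"
      using order[of 2] \<delta>(1) by auto
    ultimately show "z ^ q = -1 \<and> z \<noteq> -1" ..
  qed
  finally show ?thesis .
qed

section \<open>Common roots of the generators\<close>

lemma geometric_sum_eq_0_iff:
  fixes w :: complex
  assumes "k > 0"
  shows "(\<Sum>i<k. w ^ i) = 0 \<longleftrightarrow> w ^ k = 1 \<and> w \<noteq> 1"
proof (cases "w = 1")
  case False
  then show ?thesis by (simp add: geometric_sum)
qed (use assms in simp)

text \<open>
  The conditions on the left are those that the geometric sums give, with \<open>u\<close> and \<open>v\<close> in them. Since \<open>u\<close> is
  prime to $k$ and \<open>v\<close> is prime to $m$, both disappear; the three identities at the start of the proof
  are $um + vk = 1$ multiplied by $m$, $k$ and $mk$.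
\<close>

lemma coprime_bezout_divisibility:
  fixes u v :: int and m k d :: nat
  assumes uv: "u * int m + v * int k = 1"
  shows "int d dvd u * int m * int k \<and> \<not> int d dvd u * int m \<and>
      int d dvd v * int k * int m \<and> \<not> int d dvd v * int k \<longleftrightarrow>
    d dvd m * k \<and> \<not> d dvd m \<and> \<not> d dvd k"
proof -
  have "int m * (u * int m + v * int k) = int m * (u * int m) + v * (int m * int k)"
    and "int k * (u * int m + v * int k) = u * (int m * int k) + int k * (v * int k)"
    and "int m * int k * (u * int m + v * int k) =
      int m * (u * int m * int k) + int k * (v * int k * int m)"
    by (simp_all add: algebra_simps)
  then have m: "int m = int m * (u * int m) + v * (int m * int k)"
    and k: "int k = u * (int m * int k) + int k * (v * int k)"
    and mk: "int m * int k = int m * (u * int m * int k) + int k * (v * int k * int m)"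
    unfolding uv by simp_all
  have int_mk: "d dvd m * k \<longleftrightarrow> int d dvd int m * int k"
    by (simp flip: of_nat_mult)
  have "int d dvd u * int m * int k \<and> int d dvd v * int k * int m \<longleftrightarrow> d dvd m * k"
    unfolding int_mk
  proof
    assume "int d dvd u * int m * int k \<and> int d dvd v * int k * int m"
    then have "int d dvd int m * (u * int m * int k) + int k * (v * int k * int m)"
      by (intro dvd_add dvd_mult[of "int d" "u * int m * int k"] dvd_mult[of "int d" "v * int k * int m"])
        simp_all
    then show "int d dvd int m * int k"
      by (simp only: mk[symmetric])
  next
    assume "int d dvd int m * int k"
    then have "int d dvd u * (int m * int k)" "int d dvd v * (int m * int k)"
      by (rule dvd_mult)+
    then show "int d dvd u * int m * int k \<and> int d dvd v * int k * int m"
      by (simp add: mult_ac)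
  qed
  moreover have "int d dvd u * int m \<longleftrightarrow> d dvd m" if "d dvd m * k"
    using that unfolding int_mk by (metis m dvd_add dvd_mult int_dvd_int_iff)
  moreover have "int d dvd v * int k \<longleftrightarrow> d dvd k" if "d dvd m * k"
    using that unfolding int_mk by (metis k dvd_add dvd_mult int_dvd_int_iff)
  ultimately show ?thesis by blast
qed

lemma poly_cpoly_cong_x_powi:
  assumes "cong_x_powi P E e" "poly (cpoly P) z = 0" "z \<noteq> 0"
  shows "poly (cpoly E) z = z powi e"
proof -
  have cong: "poly (cpoly f) z = poly (cpoly g) z" if "[f = g] (mod P)" for f g
  proof -
    from that have "cpoly P dvd cpoly f - cpoly g"
      by (simp add: cong_iff_dvd_diff cpoly.hom_dvd flip: cpoly.hom_minus)
    then obtain c where "cpoly f - cpoly g = cpoly P * c" ..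
    then have "poly (cpoly f - cpoly g) z = 0"
      using assms(2) by simp
    then show ?thesis by simp
  qed
  show ?thesis
  proof (cases "e \<ge> 0")
    case True
    with assms(1) cong[of E "[:0, 1:] ^ nat e"] show ?thesis
      by (simp add: cong_x_powi_def cpoly.hom_power power_int_def)
  next
    case False
    with assms(1) cong[of "E * [:0, 1:] ^ nat (- e)" 1]
    have "poly (cpoly E) z * z ^ nat (- e) = 1"
      by (simp add: cong_x_powi_def cpoly.hom_power cpoly.hom_mult)
    with False assms(3) show ?thesis
      by (simp add: power_int_def field_simps)
  qed
qed

text \<open>
  Put $y = z^e$. Then $xy$ becomes $z^{e+1} = z^{2um}$, the ratio of the geometric sum $G_k$; and from
  $z = w z^e$ with $w = z^{1-e} = z^{2vk}$, the sum $H_m$ is $z^{e(m-1)}$ times the geometric sum of \<open>w\<close>.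
  As \<open>z\<close> has order $2\delta$, the exponents only matter modulo $\delta$ after halving.
\<close>

lemma common_root_iff:
  assumes z: "z \<in> primitive_roots (2 * \<delta>)" "\<delta> > 0"
    and km: "k > 0" "m > 0"
    and uv: "u * int m + v * int k = 1" and e: "e = u * int m - v * int k"
    and E: "poly (cpoly E) z = z powi e"
  shows "poly (cpoly (poly (G_poly k) E)) z = 0 \<and> poly (cpoly (poly (H_poly m) E)) z = 0 \<longleftrightarrow>
    \<delta> dvd m * k \<and> \<not> \<delta> dvd m \<and> \<not> \<delta> dvd k"
proof -
  have z0: "z \<noteq> 0"
    using primitive_roots_nonzero z by simp
  have order: "z powi (2 * j) = 1 \<longleftrightarrow> int \<delta> dvd j" for j
    using primitive_roots_powi_eq_1_iff[OF z(1), of "2 * j"] z(2) by simp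
  have "poly (cpoly (poly (G_poly k) E)) z = (\<Sum>i<k. (z * z powi e) ^ i)"
    by (simp add: G_poly_eq xR_def yR_def poly_sum cpoly.hom_sum cpoly.hom_power cpoly.hom_mult E)
  moreover have "z * z powi e = z powi (2 * (u * int m))"
  proof -
    have "e + 1 = 2 * (u * int m)" using uv e by simp
    then show ?thesis using z0 by (metis mult.commute power_int_add_1)
  qed
  moreover have "(z powi (2 * (u * int m))) ^ k = z powi (2 * (u * int m * int k))"
    by (simp add: power_int_mult flip: mult.assoc) 
  ultimately have G: "poly (cpoly (poly (G_poly k) E)) z = 0 \<longleftrightarrow>
      int \<delta> dvd u * int m * int k \<and> \<not> int \<delta> dvd u * int m"
    using km order by (simp add: geometric_sum_eq_0_iff)
  \<comment> \<open>The ratio $z / z^e$ of consecutive terms of $H_m(z, z^e)$.\<close>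
  define w where "w = z powi (2 * (v * int k))"
  have zw: "z = w * z powi e"
  proof -
    have "2 * (v * int k) + e = 1" using uv e by simp
    then show ?thesis using z0 by (metis w_def power_int_1_right power_int_add)
  qed
  have e0: "z powi e \<noteq> 0" using z0 by simp
  have "poly (cpoly (poly (H_poly m) E)) z = (\<Sum>i<m. (z powi e) ^ (m - Suc i) * z ^ i)"
    by (simp add: H_poly_eq xR_def yR_def poly_sum cpoly.hom_sum cpoly.hom_power cpoly.hom_mult E)
  also have "\<dots> = (\<Sum>i<m. (z powi e) ^ (m - 1) * w ^ i)"
  proof (intro sum.cong refl)
    fix i assume "i \<in> {..<m}"
    then have "m - 1 = (m - Suc i) + i" by simp
    moreover have "z ^ i = w ^ i * (z powi e) ^ i"
      by (subst zw) (simp add: power_mult_distrib)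
    ultimately show "(z powi e) ^ (m - Suc i) * z ^ i = (z powi e) ^ (m - 1) * w ^ i"
      by (simp add: power_add)
  qed
  also have "\<dots> = (z powi e) ^ (m - 1) * (\<Sum>i<m. w ^ i)"
    by (simp add: sum_distrib_left)
  finally have "poly (cpoly (poly (H_poly m) E)) z = (z powi e) ^ (m - 1) * (\<Sum>i<m. w ^ i)" .
  moreover have "(z powi e) ^ (m - 1) \<noteq> 0"
    using e0 by (rule power_not_zero)
  ultimately have "poly (cpoly (poly (H_poly m) E)) z = 0 \<longleftrightarrow> w ^ m = 1 \<and> w \<noteq> 1"
    using geometric_sum_eq_0_iff[OF km(2), of w] by (simp only: mult_eq_0_iff simp_thms)
  moreover have "w ^ m = z powi (2 * (v * int k * int m))"
    by (simp add: w_def power_int_mult flip: mult.assoc)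
  ultimately have H: "poly (cpoly (poly (H_poly m) E)) z = 0 \<longleftrightarrow>
      int \<delta> dvd v * int k * int m \<and> \<not> int \<delta> dvd v * int k"
    using order by (simp add: w_def)
  show ?thesis
    using coprime_bezout_divisibility[OF uv, of \<delta>] unfolding G H by blast
qed

section \<open>Reduced Groebner bases\<close>

lemma lead_monom_eq:
  assumes "f \<noteq> 0"
  shows "lead_monom f = (degree f, degree (lead_coeff f))"
  unfolding lead_monom_def
proof (rule the_equality)
  have max: "t = (degree f, degree (lead_coeff f)) \<or>
      (t, (degree f, degree (lead_coeff f))) \<in> less_than <*lex*> less_than" if "t \<in> monoms f" for t
  proof -
    obtain i j where t: "t = (i, j)"
      by force
    with that have nz: "coeff (coeff f i) j \<noteq> 0"
      by (simp add: monoms_def)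
    then have "coeff f i \<noteq> 0" by auto
    then have "i \<le> degree f" by (rule le_degree)
    moreover have "j \<le> degree (coeff f i)"
      using nz by (rule le_degree)
    ultimately show ?thesis
      by (cases "i = degree f") (auto simp: t)
  qed
  moreover have lm: "(degree f, degree (lead_coeff f)) \<in> monoms f"
    using assms by (simp add: monoms_def)
  ultimately show "(degree f, degree (lead_coeff f)) \<in> monoms f \<and>
    (\<forall>t\<in>monoms f. t = (degree f, degree (lead_coeff f)) \<or>
      (t, (degree f, degree (lead_coeff f))) \<in> less_than <*lex*> less_than)" by blast
  fix s assume s: "s \<in> monoms f \<and> (\<forall>t\<in>monoms f. t = s \<or> (t, s) \<in> less_than <*lex*> less_than)"
  have "asym (less_than <*lex*> less_than)"
    by (simp add: asym_lex_prod asym_less_than)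
  then show "s = (degree f, degree (lead_coeff f))"
    using max[of s] s lm by (auto dest: asymD)
qed

lemma lead_monom_in_monoms: "f \<noteq> 0 \<Longrightarrow> lead_monom f \<in> monoms f"
  by (simp add: lead_monom_eq monoms_def)

lemma lead_cf_eq: "f \<noteq> 0 \<Longrightarrow> lead_cf f = lead_coeff (lead_coeff f)"
  by (simp add: lead_cf_def lead_monom_eq)

lemma reduced_groebner_basis_UNIV: "reduced_groebner_basis UNIV G \<longleftrightarrow> G = {1}"
proof
  assume "G = {1}"
  moreover have "lead_monom 1 = (0, 0)" "lead_cf 1 = 1"
    by (simp_all add: lead_monom_eq lead_cf_eq)
  ultimately show "reduced_groebner_basis UNIV G"
    by (simp add: reduced_groebner_basis_def groebner_basis_def monom_dvd_def)
next
  assume G: "reduced_groebner_basis UNIV G"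
  then obtain g where g: "g \<in> G" "monom_dvd (lead_monom g) (lead_monom 1)"
    unfolding reduced_groebner_basis_def groebner_basis_def by (metis UNIV_I zero_neq_one)
  have nz: "g' \<noteq> 0" if "g' \<in> G" for g'
    using G that by (auto simp: reduced_groebner_basis_def groebner_basis_def)
  have lm: "lead_monom g = (0, 0)"
    using g(2) by (simp add: lead_monom_eq monom_dvd_def prod_eq_iff)
  then have "degree g = 0"
    using nz[OF g(1)] by (simp add: lead_monom_eq)
  then obtain b where b: "g = [:b:]"
    by (metis degree_eq_zeroE)
  then have "degree b = 0"
    using lm nz[OF g(1)] by (simp add: lead_monom_eq)
  then obtain c where c: "g = [:[:c:]:]"
    using b by (metis degree_eq_zeroE)
  moreover have "lead_cf g = 1"
    using G g(1) by (simp add: reduced_groebner_basis_def)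
  ultimately have "g = 1"
    using nz[OF g(1)] by (simp add: lead_cf_eq)
  moreover have "g' = g" if "g' \<in> G" for g'
  proof (rule ccontr)
    assume "g' \<noteq> g"
    then have "\<not> monom_dvd (lead_monom g) (lead_monom g')"
      using G that g(1) lead_monom_in_monoms[OF nz[OF that]]
      by (auto simp: reduced_groebner_basis_def)
    then show False
      by (simp add: lm monom_dvd_def)
  qed
  ultimately show "G = {1}"
    using g(1) by blast
qed

lemma shape_ideal_mem_iff: "f \<in> ideal_gen {[:P:], yR - [:h:]} \<longleftrightarrow> P dvd poly f h"
proof
  assume "f \<in> ideal_gen {[:P:], yR - [:h:]}"
  then obtain a b where "f = a * [:P:] + b * (yR - [:h:])"
    unfolding ideal_gen_pair_iff by blast
  then show "P dvd poly f h"
    by (simp add: yR_def)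
next
  assume "P dvd poly f h"
  then have "[:P:] dvd [:poly f h:]"
    by (rule const_poly.hom_dvd)
  then have "[:poly f h:] \<in> ideal_gen {[:P:], yR - [:h:]}"
    by (rule ideal_gen_dvd[rotated]) (simp add: ideal_gen_base)
  moreover have "ideal_cong {[:P:], yR - [:h:]} yR [:h:]"
    by (simp add: ideal_cong_def ideal_gen_base)
  ultimately show "f \<in> ideal_gen {[:P:], yR - [:h:]}"
    using ideal_cong_mem_iff[OF ideal_cong_poly_eval] by blast
qed

lemma monic_dvd_same_degree:
  fixes p c :: "'a::idom poly"
  assumes "p dvd c" "lead_coeff p = 1" "lead_coeff c = 1" "degree c = degree p"
  shows "c = p"
proof -
  from assms(1) obtain d where d: "c = p * d" ..
  have "p \<noteq> 0" "c \<noteq> 0"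
    using assms(2,3) by auto
  then have "d \<noteq> 0" "degree d = 0"
    using assms(4) d by (auto simp: degree_mult_eq)
  then obtain a where "d = [:a:]"
    by (metis degree_eq_zeroE)
  moreover have "lead_coeff c = lead_coeff p * lead_coeff d"
    by (simp only: d lead_coeff_mult)
  ultimately have "d = 1"
    using assms(2,3) by simp
  with d show ?thesis by simp
qed

text \<open>
  A member of the ideal whose leading monomial is prime to $y$ is a polynomial in $x$ alone, and then a
  multiple of \<open>P\<close>. So the leading monomials are the multiples of $y$ and of $x^n$ with $n = \deg P$, and
  a reduced basis consists of one monic element for each of these two. The second one is $P$ itself.
  The first one is $y + a(x)$ with $\deg a < n$ by reducedness; as $P$ divides $a + h$, it is $y - h$.
\<close>

lemma reduced_groebner_basis_shape:
  fixes P h :: "rat poly"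
  assumes P: "lead_coeff P = 1" "degree P > 0" and h: "degree h < degree P"
  shows "reduced_groebner_basis (ideal_gen {[:P:], yR - [:h:]}) G \<longleftrightarrow> G = {yR - [:h:], [:P:]}"
proof -
  define I where "I = ideal_gen {[:P:], yR - [:h:]}"
  have I: "f \<in> I \<longleftrightarrow> P dvd poly f h" for f
    unfolding I_def by (rule shape_ideal_mem_iff)
  have y: "yR - [:h:] = [:- h, 1:]"
    by (simp add: yR_def)
  have P0: "P \<noteq> 0"
    using P(2) by auto
  have lm_y: "lead_monom (yR - [:h:]) = (1, 0)" and lc_y: "lead_cf (yR - [:h:]) = 1"
    unfolding y by (simp_all add: lead_monom_eq lead_cf_eq)
  have lm_P: "lead_monom [:P:] = (0, degree P)" and lc_P: "lead_cf [:P:] = 1"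
    using P P0 by (simp_all add: lead_monom_eq lead_cf_eq)
  have y_nz: "yR - [:h:] \<noteq> 0"
    unfolding y by simp
  have y_I: "yR - [:h:] \<in> I" and P_I: "[:P:] \<in> I"
    by (simp_all add: I y)
  have const: "degree P \<le> snd (lead_monom f) \<and> (\<exists>c. f = [:c:] \<and> P dvd c)"
    if "f \<in> I" "f \<noteq> 0" "fst (lead_monom f) = 0" for f
  proof -
    have "degree f = 0"
      using that by (simp add: lead_monom_eq)
    then obtain c where c: "f = [:c:]"
      by (metis degree_eq_zeroE)
    then have "P dvd c" "c \<noteq> 0"
      using that I by simp_all
    then have "degree P \<le> degree c"
      by (rule dvd_imp_degree_le)
    with c that \<open>P dvd c\<close> show ?thesis
      by (simp add: lead_monom_eq)
  qed
  show ?thesis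
    unfolding I_def[symmetric]
  proof
    assume G: "G = {yR - [:h:], [:P:]}"
    have "\<exists>g\<in>G. monom_dvd (lead_monom g) (lead_monom f)" if "f \<in> I" "f \<noteq> 0" for f
    proof (cases "fst (lead_monom f) = 0")
      case True
      then have "monom_dvd (lead_monom [:P:]) (lead_monom f)"
        using const[OF that] by (simp add: lm_P monom_dvd_def)
      then show ?thesis by (simp add: G)
    next
      case False
      then have "monom_dvd (lead_monom (yR - [:h:])) (lead_monom f)"
        by (simp add: lm_y monom_dvd_def)
      then show ?thesis by (simp add: G)
    qed
    then have "groebner_basis I G"
      using y_I P_I y_nz P0 by (auto simp: groebner_basis_def G)
    moreover have "\<not> monom_dvd (lead_monom [:P:]) t" if "t \<in> monoms (yR - [:h:])" for t
    proof -
      obtain i j where t: "t = (i, j)" "coeff (coeff [:- h, 1:] i) j \<noteq> 0"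
        using \<open>t \<in> monoms _\<close> by (auto simp: monoms_def y)
      have "j < degree P"
      proof (cases i)
        case 0
        then have "coeff h j \<noteq> 0" using t by simp
        then have "j \<le> degree h" by (rule le_degree)
        with h show ?thesis by simp
      next
        case (Suc i')
        with t have "j = 0"
          by (cases i'; cases j) (simp_all add: coeff_pCons)
        with P show ?thesis by simp
      qed
      then show ?thesis
        by (simp add: lm_P monom_dvd_def t)
    qed
    moreover have "\<not> monom_dvd (lead_monom (yR - [:h:])) t" if "t \<in> monoms [:P:]" for t
    proof -
      have "fst t = 0"
        using that by (auto simp: monoms_def coeff_pCons split: nat.splits)
      then show ?thesis
        by (simp add: lm_y monom_dvd_def)
    qed
    ultimately show "reduced_groebner_basis I G"
      unfolding reduced_groebner_basis_def G by (auto simp: lc_y lc_P)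
  next
    assume G: "reduced_groebner_basis I G"
    have GI: "g \<in> I" and nz: "g \<noteq> 0" and lc: "lead_cf g = 1" if "g \<in> G" for g
      using G that by (auto simp: reduced_groebner_basis_def groebner_basis_def)
    have cover: "\<exists>g\<in>G. monom_dvd (lead_monom g) (lead_monom f)" if "f \<in> I" "f \<noteq> 0" for f
      using G that by (simp add: reduced_groebner_basis_def groebner_basis_def)
    have reduced: "\<not> monom_dvd (lead_monom g') t" if "g \<in> G" "g' \<in> G" "g' \<noteq> g" "t \<in> monoms g" for g g' t
      using G that by (auto simp: reduced_groebner_basis_def)
    obtain g1 where g1: "g1 \<in> G" "monom_dvd (lead_monom g1) (1, 0)"
      using cover[OF y_I y_nz] by (auto simp: lm_y)
    obtain g2 where g2: "g2 \<in> G" "monom_dvd (lead_monom g2) (0, degree P)"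
      using cover[OF P_I] P0 by (auto simp: lm_P)
    have "fst (lead_monom g1) \<noteq> 0"
      using const[OF GI[OF g1(1)] nz[OF g1(1)]] g1(2) P(2) by (auto simp: monom_dvd_def)
    then have lm1: "lead_monom g1 = (1, 0)"
      using g1(2) by (simp add: monom_dvd_def prod_eq_iff)
    have fst2: "fst (lead_monom g2) = 0"
      using g2(2) by (simp add: monom_dvd_def)
    then obtain c where c: "g2 = [:c:]" "P dvd c" and deg2: "degree P \<le> snd (lead_monom g2)"
      using const[OF GI[OF g2(1)] nz[OF g2(1)]] by blast
    have lm2: "lead_monom g2 = (0, degree P)"
      using fst2 deg2 g2(2) by (simp add: monom_dvd_def prod_eq_iff)
    have G_eq: "G = {g1, g2}"
    proof -
      have "g = g1 \<or> g = g2" if g: "g \<in> G" for g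
      proof (rule ccontr)
        assume "\<not> (g = g1 \<or> g = g2)"
        then have "g1 \<noteq> g" "g2 \<noteq> g"
          by auto
        then have "\<not> monom_dvd (lead_monom g1) (lead_monom g)" "\<not> monom_dvd (lead_monom g2) (lead_monom g)"
          using reduced[OF g _ _ lead_monom_in_monoms[OF nz[OF g]]] g1(1) g2(1) by simp_all
        then show False
          using const[OF GI[OF g] nz[OF g]] by (auto simp: lm1 lm2 monom_dvd_def)
      qed
      with g1(1) g2(1) show ?thesis by blast
    qed
    have "c \<noteq> 0" "degree c = degree P" "lead_coeff c = 1"
      using lm2 lc[OF g2(1)] nz[OF g2(1)] by (simp_all add: c lead_monom_eq lead_cf_eq)
    then have "g2 = [:P:]"
      using monic_dvd_same_degree[OF c(2) P(1)] by (simp add: c)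
    have deg1: "degree g1 = 1"
      using lm1 nz[OF g1(1)] by (simp add: lead_monom_eq)
    then have "degree (coeff g1 1) = 0" "lead_coeff (coeff g1 1) = 1"
      using lm1 lc[OF g1(1)] nz[OF g1(1)] by (simp_all add: lead_monom_eq lead_cf_eq)
    then have lc1: "coeff g1 1 = 1"
      by (metis coeff_pCons_0 degree_eq_zeroE one_pCons)
    obtain a where a: "g1 = [:a, 1:]"
    proof
      show "g1 = [:coeff g1 0, 1:]"
      proof (rule poly_eqI)
        fix i
        consider "i = 0" | "i = 1" | "i > degree g1"
          using deg1 by linarith
        then show "coeff g1 i = coeff [:coeff g1 0, 1:] i"
          using lc1 deg1 by cases (simp_all add: coeff_eq_0)
      qed
    qed
    have "g2 \<noteq> g1"
      using lm1 lm2 by auto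
    then have "coeff a j = 0" if "j \<ge> degree P" for j
      using reduced[OF g1(1) g2(1), of "(0, j)"] that by (auto simp: a lm2 monoms_def monom_dvd_def)
    then have "degree a < degree P"
      using P(2) by (metis degree_0 leading_coeff_0_iff not_le)
    then have "degree (a + h) < degree P"
      using h by (rule degree_add_less)
    moreover have "P dvd a + h"
      using GI[OF g1(1)] by (simp add: I a add.commute)
    ultimately have "a + h = 0"
      using dvd_imp_degree_le leD by blast
    then have "g1 = yR - [:h:]"
      by (simp add: a y eq_neg_iff_add_eq_0)
    with \<open>g2 = [:P:]\<close> G_eq show "G = {yR - [:h:], [:P:]}" by simp
  qed
qed

section \<open>Greatest common divisors over $\mathcal{K}_\delta$\<close>

lemma degree_mod_less_pos:
  fixes P f :: "'a::field poly"
  assumes "degree P > 0"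
  shows "degree (f mod P) < degree P"
proof -
  have "P \<noteq> 0"
    using assms by auto
  then show ?thesis
    using degree_mod_less[of P f] assms by (cases "f mod P = 0") auto
qed

context
  fixes \<delta> :: nat and \<Phi> :: "rat poly"
  assumes \<delta>: "\<delta> > 0"
  defines "\<Phi> \<equiv> cyclotomic (2 * \<delta>)"
begin

lemma degree_\<Phi>_pos: "degree \<Phi> > 0"
  using degree_cyclotomic_pos[of "2 * \<delta>"] \<delta> by (simp add: \<Phi>_def)

lemma coeff_K_red: "coeff (K_red \<delta> p) i = coeff p i mod \<Phi>"
  by (simp add: K_red_def coeff_map_poly \<Phi>_def)

lemma K_red_in_K_polys: "K_red \<delta> p \<in> K_polys \<delta>"
  by (simp add: K_polys_def coeff_K_red \<Phi>_def[symmetric] degree_mod_less_pos[OF degree_\<Phi>_pos])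

lemma K_red_id: "p \<in> K_polys \<delta> \<Longrightarrow> K_red \<delta> p = p"
  by (intro poly_eqI) (simp add: coeff_K_red K_polys_def mod_poly_less \<Phi>_def)

lemma K_red_eq_iff: "K_red \<delta> p = K_red \<delta> p' \<longleftrightarrow> [:\<Phi>:] dvd p - p'"
proof -
  have "K_red \<delta> p = K_red \<delta> p' \<longleftrightarrow> (\<forall>i. coeff p i mod \<Phi> = coeff p' i mod \<Phi>)"
    by (metis coeff_K_red poly_eqI)
  then show ?thesis
    by (simp add: const_poly_dvd_iff mod_eq_dvd_iff)
qed

text \<open>
  Divisibility in $\mathcal{K}_\delta[y]$ is membership in an ideal of $\mathbb{Q}[x,y]$ that contains
  $\Phi_{2\delta}$. This transfers the gcd to the ideals treated above.
\<close>

lemma K_dvd_iff: "K_dvd \<delta> p (K_red \<delta> f) \<longleftrightarrow> f \<in> ideal_gen {[:\<Phi>:], p}"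
proof
  assume "K_dvd \<delta> p (K_red \<delta> f)"
  then obtain c where "[:\<Phi>:] dvd f - p * c"
    unfolding K_dvd_def K_red_eq_iff by blast
  then obtain a where "f - p * c = [:\<Phi>:] * a" ..
  then have "f = a * [:\<Phi>:] + c * p"
    by (simp add: algebra_simps)
  then show "f \<in> ideal_gen {[:\<Phi>:], p}"
    unfolding ideal_gen_pair_iff by blast
next
  assume "f \<in> ideal_gen {[:\<Phi>:], p}"
  then obtain a c where f: "f = a * [:\<Phi>:] + c * p"
    unfolding ideal_gen_pair_iff by blast
  have "K_red \<delta> (K_red \<delta> c) = K_red \<delta> c"
    by (rule K_red_id[OF K_red_in_K_polys])
  then obtain b where "K_red \<delta> c - c = [:\<Phi>:] * b"
    unfolding K_red_eq_iff by blast
  then have "K_red \<delta> c = c + [:\<Phi>:] * b"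
    by (simp add: algebra_simps)
  then have "f - p * K_red \<delta> c = [:\<Phi>:] * (a - p * b)"
    by (simp add: f algebra_simps)
  then have "K_red \<delta> f = K_red \<delta> (p * K_red \<delta> c)"
    unfolding K_red_eq_iff by (metis dvd_triv_left)
  then show "K_dvd \<delta> p (K_red \<delta> f)"
    unfolding K_dvd_def using K_red_in_K_polys by blast
qed

text \<open>
  A monic polynomial cannot lose degree in a product over $\mathcal{K}_\delta$, so two monic polynomials
  that divide each other are equal.
\<close>

lemma K_dvd_monic:
  assumes p: "p \<in> K_polys \<delta>" "lead_coeff p = 1" and p': "p' \<in> K_polys \<delta>" "lead_coeff p' = 1"
    and "K_dvd \<delta> p p'"
  shows "degree p \<le> degree p'" and "degree p = degree p' \<Longrightarrow> p = p'"
proof -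
  obtain c where c: "c \<in> K_polys \<delta>" "p' = K_red \<delta> (p * c)"
    using assms(5) by (auto simp: K_dvd_def)
  have "p \<noteq> 0" "p' \<noteq> 0"
    using p p' by auto
  have "c \<noteq> 0"
    using c(2) \<open>p' \<noteq> 0\<close> by (auto simp: K_red_def)
  have "lead_coeff (p * c) = lead_coeff c"
    using p(2) by (simp add: lead_coeff_mult)
  then have "coeff p' (degree (p * c)) = lead_coeff c"
    using c(1) by (simp add: c(2) coeff_K_red mod_poly_less K_polys_def \<Phi>_def)
  then have "degree (p * c) \<le> degree p'"
    using \<open>c \<noteq> 0\<close> by (intro le_degree) simp
  moreover have "degree p' \<le> degree (p * c)"
    unfolding c(2) K_red_def by (rule degree_map_poly_le)
  ultimately have deg: "degree p' = degree p + degree c"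
    using \<open>p \<noteq> 0\<close> \<open>c \<noteq> 0\<close> by (simp add: degree_mult_eq)
  then show "degree p \<le> degree p'" by simp
  assume "degree p = degree p'"
  then have "degree c = 0"
    using deg by simp
  moreover have "lead_coeff c = 1"
    using \<open>coeff p' (degree (p * c)) = lead_coeff c\<close> p'(2) \<open>degree (p * c) \<le> degree p'\<close>
      \<open>degree p' \<le> degree (p * c)\<close> by (metis le_antisym)
  ultimately have "c = 1"
    by (metis degree_eq_zeroE lead_coeff_pCons(2) pCons_one)
  then show "p = p'"
    using K_red_id[OF p(1)] by (simp add: c(2))
qed

lemma K_monic_gcdI:
  assumes p: "p \<in> K_polys \<delta>" "lead_coeff p = 1"
    and eq: "ideal_gen {[:\<Phi>:], f, g} = ideal_gen {[:\<Phi>:], p}"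
  shows "K_monic_gcd \<delta> (K_red \<delta> f) (K_red \<delta> g) p"
proof -
  have "f \<in> ideal_gen {[:\<Phi>:], p}" "g \<in> ideal_gen {[:\<Phi>:], p}"
    unfolding eq[symmetric] by (simp_all add: ideal_gen_base)
  moreover have "K_dvd \<delta> c p"
    if "K_dvd \<delta> c (K_red \<delta> f)" "K_dvd \<delta> c (K_red \<delta> g)" for c
  proof -
    have "ideal_gen {[:\<Phi>:], f, g} \<subseteq> ideal_gen {[:\<Phi>:], c}"
      using that by (intro ideal_gen_subsetI) (simp add: K_dvd_iff ideal_gen_base)
    moreover have "p \<in> ideal_gen {[:\<Phi>:], p}"
      by (simp add: ideal_gen_base)
    ultimately show ?thesis
      using K_dvd_iff[of c p] K_red_id[OF p(1)] eq by auto
  qed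
  ultimately show ?thesis
    using p by (simp add: K_monic_gcd_def K_dvd_iff)
qed

text \<open>
  A monic generator of the ideal of $G_k(x_\delta, y)$ and $H_m(x_\delta, y)$ is their gcd, and by
  \<open>K_dvd_monic\<close> there is only one monic gcd.
\<close>

lemma p_delta_eqI:
  assumes p: "p \<in> K_polys \<delta>" "lead_coeff p = 1"
    and eq: "ideal_gen {[:\<Phi>:], G_poly k, H_poly m} = ideal_gen {[:\<Phi>:], p}"
  shows "p_delta k m \<delta> = p"
  unfolding p_delta_def
proof (rule the_equality)
  show gcd: "K_monic_gcd \<delta> (K_red \<delta> (G_poly k)) (K_red \<delta> (H_poly m)) p"
    by (rule K_monic_gcdI[OF p eq])
  fix p' assume gcd': "K_monic_gcd \<delta> (K_red \<delta> (G_poly k)) (K_red \<delta> (H_poly m)) p'"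
  then have p': "p' \<in> K_polys \<delta>" "lead_coeff p' = 1"
    by (simp_all add: K_monic_gcd_def)
  have "K_dvd \<delta> p p'" "K_dvd \<delta> p' p"
    using gcd gcd' by (simp_all add: K_monic_gcd_def)
  then show "p' = p"
    using K_dvd_monic[OF p p'] K_dvd_monic[OF p' p] by (metis le_antisym)
qed

end

section \<open>The set $\mathcal{D}$ and the ideal of the link\<close>

lemma coprime_X_A_poly: "odd q \<Longrightarrow> coprime [:0, 1:] (A_poly q)"
proof (rule coprimeI)
  fix c assume q: "odd q" and c: "c dvd [:0, 1:]" "c dvd A_poly q"
  have "poly (A_poly q - 1) 0 = 0"
    using q by (simp add: A_poly_eq poly_sum power_0_left odd_pos if_distrib cong: if_cong)
  then have "[:0, 1:] dvd A_poly q - 1"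
    using poly_eq_0_iff_dvd[of "A_poly q - 1" 0] by simp
  with c(1) have "c dvd A_poly q - 1"
    by (rule dvd_trans)
  from dvd_diff[OF c(2) this] show "c dvd 1" by simp
qed

text \<open>
  For coprime $m$ and $k$ these are the divisors $\delta > 1$ of \<open>q\<close> that split as $\delta = ab$ with
  $a, b > 1$, $a \mid m$ and $b \mid k$.
\<close>

definition split_divisors :: "nat \<Rightarrow> nat \<Rightarrow> nat \<Rightarrow> nat set" where
  "split_divisors k q m = {\<delta>. \<delta> > 1 \<and> \<delta> dvd q \<and> \<delta> dvd m * k \<and> \<not> \<delta> dvd m \<and> \<not> \<delta> dvd k}"

text \<open>
  $\Phi_{2\delta}$ has simple roots, all of them roots of $A_q$, so it equals its gcd with $A_q$.
\<close>

lemma cyclotomic_dvd_A_poly: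
  assumes "odd q" "\<delta> > 1" "\<delta> dvd q"
  shows "cyclotomic (2 * \<delta>) dvd A_poly q"
proof -
  have eq: "cpoly (cyclotomic (2 * \<delta>)) = linear_product (primitive_roots (2 * \<delta>))"
    using assms by (intro cpoly_cyclotomic) simp
  have fin: "finite (primitive_roots (2 * \<delta>))"
    using assms by (intro finite_primitive_roots) simp
  have "poly (cpoly (A_poly q)) z = 0" if "z \<in> primitive_roots (2 * \<delta>)" for z
    using that assms by (auto simp: A_poly_root_iff)
  then have "{z. poly (cpoly (cyclotomic (2 * \<delta>))) z = 0 \<and> poly (cpoly (A_poly q)) z = 0 \<and>
      poly (cpoly (A_poly q)) z = 0} = primitive_roots (2 * \<delta>)"
    by (auto simp: eq poly_linear_product_eq_0_iff fin)
  then have "gcd (cyclotomic (2 * \<delta>)) (gcd (A_poly q) (A_poly q)) = cyclotomic (2 * \<delta>)"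
    by (intro gcd_eq_linear_product) (simp_all add: eq fin finite_linear_product_rsquarefree)
  then show ?thesis
    by (metis dvd_trans gcd_dvd1 gcd_dvd2)
qed

lemma cpoly_prod_cyclotomic:
  "cpoly (\<Prod>\<delta>\<in>D. cyclotomic (2 * \<delta>)) = linear_product (\<Union>\<delta>\<in>D. primitive_roots (2 * \<delta>))"
  if "finite D" "0 \<notin> D"
proof -
  have pos: "\<delta> > 0" if "\<delta> \<in> D" for \<delta>
    using that \<open>0 \<notin> D\<close> by (metis gr0I)
  have "linear_product (\<Union>\<delta>\<in>D. primitive_roots (2 * \<delta>)) =
      (\<Prod>\<delta>\<in>D. linear_product (primitive_roots (2 * \<delta>)))"
  proof (rule linear_product_UN[OF that(1)])
    show "finite (primitive_roots (2 * \<delta>))" if "\<delta> \<in> D" for \<delta>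
      using pos[OF that] by (intro finite_primitive_roots) simp
    show "primitive_roots (2 * a) \<inter> primitive_roots (2 * b) = {}"
      if "a \<in> D" "b \<in> D" "a \<noteq> b" for a b
      using pos[OF that(1)] pos[OF that(2)] that(3) primitive_roots_disjoint[of _ "2 * a" "2 * b"] by auto
  qed
  also have "\<dots> = (\<Prod>\<delta>\<in>D. cpoly (cyclotomic (2 * \<delta>)))"
    using pos by (intro prod.cong refl) (simp add: cpoly_cyclotomic)
  finally show ?thesis
    by (simp add: cpoly.hom_prod)
qed

context
  fixes k m q :: nat and u v e :: int and E :: "rat poly"
  assumes km: "k \<ge> 1" "m \<ge> 1" and q: "odd q"
    and uv: "u * int m + v * int k = 1" and e: "e = u * int m - v * int k"
    and E: "cong_x_powi (A_poly q) E e"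
begin

lemma ideal_eliminated:
  assumes "P dvd A_poly q"
  shows "ideal_gen {[:P:], G_poly k, H_poly m} =
    ideal_gen {[:gcd P (gcd (poly (G_poly k) E) (poly (H_poly m) E)):], yR - [:E:]}"
proof (rule ideal_gen_eliminate_y)
  show "ideal_cong {[:P:], G_poly k, H_poly m} yR [:E:]"
    by (rule yR_cong_x_powi[OF _ _ _ km uv e cong_x_powi_dvd[OF E assms]])
      (simp_all add: ideal_gen_base)
qed

lemma common_root_of_unity_iff:
  assumes "\<delta> > 1" "\<delta> dvd q" "z \<in> primitive_roots (2 * \<delta>)"
  shows "poly (cpoly (poly (G_poly k) E)) z = 0 \<and> poly (cpoly (poly (H_poly m) E)) z = 0 \<longleftrightarrow>
    \<delta> \<in> split_divisors k q m"
proof -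
  have "poly (cpoly (A_poly q)) z = 0"
    using assms q by (auto simp: A_poly_root_iff)
  moreover have "z \<noteq> 0"
    using assms primitive_roots_nonzero[of z "2 * \<delta>"] by simp
  ultimately have "poly (cpoly E) z = z powi e"
    using poly_cpoly_cong_x_powi[OF E] by blast
  with common_root_iff[OF assms(3) _ _ _ uv e] assms km show ?thesis
    by (simp add: split_divisors_def)
qed

text \<open>
  All roots of $\Phi_{2\delta}$ are common roots of the generators, or none is. Accordingly, the gcd in the
  eliminated ideal is $\Phi_{2\delta}$ or $1$, and $p_\delta$ is $y - x_\delta^e$ or $1$.
\<close>

lemma d_delta_eq:
  assumes "\<delta> > 1" "\<delta> dvd q"
  shows "d_delta k m \<delta> = (if \<delta> \<in> split_divisors k q m then 1 else 0)"
proof -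
  define \<Phi> where "\<Phi> = cyclotomic (2 * \<delta>)"
  have \<delta>: "\<delta> > 0" "2 * \<delta> > 0"
    using assms by simp_all
  have deg: "degree \<Phi> > 0"
    unfolding \<Phi>_def using \<delta>(2) by (rule degree_cyclotomic_pos)
  have cpoly_\<Phi>: "cpoly \<Phi> = linear_product (primitive_roots (2 * \<delta>))"
    unfolding \<Phi>_def using \<delta>(2) by (rule cpoly_cyclotomic)
  have fin: "finite (primitive_roots (2 * \<delta>))"
    using \<delta>(2) by (rule finite_primitive_roots)
  have sq: "rsquarefree (cpoly \<Phi>)"
    unfolding cpoly_\<Phi> using fin by (rule finite_linear_product_rsquarefree)
  have "{z. poly (cpoly \<Phi>) z = 0 \<and> poly (cpoly (poly (G_poly k) E)) z = 0 \<and>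
      poly (cpoly (poly (H_poly m) E)) z = 0} =
    (if \<delta> \<in> split_divisors k q m then primitive_roots (2 * \<delta>) else {})"
    using common_root_of_unity_iff[OF assms] by (auto simp: cpoly_\<Phi> poly_linear_product_eq_0_iff fin)
  then have gcd: "gcd \<Phi> (gcd (poly (G_poly k) E) (poly (H_poly m) E)) =
      (if \<delta> \<in> split_divisors k q m then \<Phi> else 1)"
    by (intro gcd_eq_linear_product[OF sq]) (simp add: cpoly_\<Phi> linear_product_def)
  have ideal: "ideal_gen {[:\<Phi>:], G_poly k, H_poly m} =
      ideal_gen {[:if \<delta> \<in> split_divisors k q m then \<Phi> else 1:], yR - [:E:]}"
    using ideal_eliminated[OF cyclotomic_dvd_A_poly[OF q assms]] gcd by (simp add: \<Phi>_def)
  show ?thesis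
  proof (cases "\<delta> \<in> split_divisors k q m")
    case True
    \<comment> \<open>The canonical representative of $y - x_\delta^e$.\<close>
    define p where "p = [:- (E mod \<Phi>), 1:]"
    have "degree (E mod \<Phi>) < degree \<Phi>"
      using deg by (rule degree_mod_less_pos)
    then have K: "p \<in> K_polys \<delta>"
      using deg by (auto simp: K_polys_def p_def \<Phi>_def[symmetric] coeff_pCons split: nat.split)
    have "\<Phi> dvd E - E mod \<Phi>"
      by (rule dvd_minus_mod)
    then have *: "[:\<Phi>:] dvd [:E - E mod \<Phi>:]"
      by (rule const_poly.hom_dvd)
    have **: "yR - [:E:] = p - [:E - E mod \<Phi>:]" "p = (yR - [:E:]) + [:E - E mod \<Phi>:]"
      by (simp_all add: yR_def p_def)
    have "ideal_gen {[:\<Phi>:], yR - [:E:]} = ideal_gen {[:\<Phi>:], p}"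
    proof (rule ideal_gen_eqI)
      have "[:E - E mod \<Phi>:] \<in> ideal_gen {[:\<Phi>:], p}" "[:E - E mod \<Phi>:] \<in> ideal_gen {[:\<Phi>:], yR - [:E:]}"
        by (rule ideal_gen_dvd[OF _ *], simp add: ideal_gen_base)+
      then show "{[:\<Phi>:], yR - [:E:]} \<subseteq> ideal_gen {[:\<Phi>:], p}" "{[:\<Phi>:], p} \<subseteq> ideal_gen {[:\<Phi>:], yR - [:E:]}"
        using ideal_gen_diff[of p "{[:\<Phi>:], p}" "[:E - E mod \<Phi>:]"]
          ideal_gen_add[of "yR - [:E:]" "{[:\<Phi>:], yR - [:E:]}" "[:E - E mod \<Phi>:]"]
        by (simp_all only: **[symmetric] insert_subset empty_subsetI ideal_gen_base insertI1 insertI2 simp_thms)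
    qed
    then have "p_delta k m \<delta> = p"
      using ideal True K by (intro p_delta_eqI[OF \<delta>(1)]) (simp_all add: p_def \<Phi>_def)
    then show ?thesis
      using True by (simp add: d_delta_def p_def)
  next
    case False
    have "ideal_gen {[:\<Phi>:], G_poly k, H_poly m} = UNIV"
      unfolding ideal using False by (intro ideal_gen_one ideal_gen_base) simp
    moreover have "ideal_gen {[:\<Phi>:], 1} = UNIV"
      by (intro ideal_gen_one ideal_gen_base) simp
    moreover have "1 \<in> K_polys \<delta>"
      using deg by (auto simp: K_polys_def \<Phi>_def)
    ultimately have "p_delta k m \<delta> = 1"
      by (intro p_delta_eqI[OF \<delta>(1)]) (simp_all add: \<Phi>_def)
    then show ?thesis
      using False by (simp add: d_delta_def)
  qed
qed

lemma D_set_eq: "D_set k q m = split_divisors k q m"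
  using d_delta_eq by (auto simp: D_set_def split_divisors_def split: if_splits)

lemma finite_split_divisors: "finite (split_divisors k q m)"
  by (rule finite_subset[of _ "{..q}"]) (use q in \<open>auto simp: split_divisors_def dest!: dvd_imp_le odd_pos\<close>)

lemma cpoly_Pi0: "cpoly (Pi0 k q m) = linear_product (\<Union>\<delta>\<in>split_divisors k q m. primitive_roots (2 * \<delta>))"
  unfolding Pi0_def D_set_eq
  by (rule cpoly_prod_cyclotomic[OF finite_split_divisors]) (simp add: split_divisors_def)

lemma Pi0_eq_gcd: "gcd (A_poly q) (gcd (poly (G_poly k) E) (poly (H_poly m) E)) = Pi0 k q m"
proof (rule gcd_eq_linear_product[OF rsquarefree_A_poly[OF q]])
  have "{z. poly (cpoly (A_poly q)) z = 0 \<and> poly (cpoly (poly (G_poly k) E)) z = 0 \<and>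
      poly (cpoly (poly (H_poly m) E)) z = 0} = (\<Union>\<delta>\<in>split_divisors k q m. primitive_roots (2 * \<delta>))"
    using common_root_of_unity_iff by (auto simp: A_poly_root_iff[OF q] split_divisors_def)
  then show "cpoly (Pi0 k q m) = linear_product {z. poly (cpoly (A_poly q)) z = 0 \<and>
      poly (cpoly (poly (G_poly k) E)) z = 0 \<and> poly (cpoly (poly (H_poly m) E)) z = 0}"
    by (simp add: cpoly_Pi0)
qed

lemma ideal_eq_shape:
  "ideal_gen {[:A_poly q:], G_poly k, H_poly m} = ideal_gen {[:Pi0 k q m:], yR - [:E:]}"
  using ideal_eliminated[of "A_poly q"] by (simp add: Pi0_eq_gcd)

lemma Pi0_dvd_A_poly: "Pi0 k q m dvd A_poly q"
  using Pi0_eq_gcd by (metis gcd_dvd1)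

lemma lead_coeff_Pi0: "lead_coeff (Pi0 k q m) = 1"
  unfolding Pi0_def lead_coeff_prod D_set_eq
  by (intro prod.neutral) (auto simp: split_divisors_def lead_coeff_cyclotomic)

lemma degree_Pi0_pos:
  assumes "D_set k q m \<noteq> {}"
  shows "degree (Pi0 k q m) > 0"
proof -
  obtain \<delta> where \<delta>: "\<delta> \<in> D_set k q m"
    using assms by blast
  then have "cyclotomic (2 * \<delta>) dvd Pi0 k q m"
    unfolding Pi0_def using finite_split_divisors by (intro dvd_prodI) (simp_all add: D_set_eq)
  moreover have "Pi0 k q m \<noteq> 0"
    using lead_coeff_Pi0 by auto
  moreover have "degree (cyclotomic (2 * \<delta>)) > 0"
    using \<delta> by (intro degree_cyclotomic_pos) (simp add: D_set_def)
  ultimately show ?thesis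
    using dvd_imp_degree_le by (metis less_le_trans)
qed

lemma h_poly_props:
  assumes "D_set k q m \<noteq> {}"
  shows "degree (h_poly k q m e) < degree (Pi0 k q m)" "[E = h_poly k q m e] (mod Pi0 k q m)"
proof -
  let ?P = "Pi0 k q m"
  have cop: "coprime [:0, 1:] ?P"
    by (rule coprime_divisors[OF dvd_refl Pi0_dvd_A_poly coprime_X_A_poly[OF q]])
  have EP: "cong_x_powi ?P E e"
    using E Pi0_dvd_A_poly by (rule cong_x_powi_dvd)
  have deg: "degree (E mod ?P) < degree ?P"
    using degree_Pi0_pos[OF assms] by (rule degree_mod_less_pos)
  have cong: "[E = E mod ?P] (mod ?P)"
    by (simp add: cong_def)
  have "h_poly k q m e = E mod ?P"
    unfolding h_poly_def
  proof (rule the_equality)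
    show "degree (E mod ?P) < degree ?P \<and> cong_x_powi ?P (E mod ?P) e"
      using deg cong_x_powi_cong[OF EP cong] by blast
    fix f assume f: "degree f < degree ?P \<and> cong_x_powi ?P f e"
    then have "[f = E] (mod ?P)"
      using cong_x_powi_unique[OF cop _ EP] by blast
    then show "f = E mod ?P"
      using f by (simp add: cong_def mod_poly_less)
  qed
  then show "degree (h_poly k q m e) < degree ?P" "[E = h_poly k q m e] (mod ?P)"
    using deg cong by simp_all
qed

lemma ideal_eq_shape_h_poly:
  assumes "D_set k q m \<noteq> {}"
  shows "ideal_gen {[:A_poly q:], G_poly k, H_poly m} =
    ideal_gen {[:Pi0 k q m:], yR - [:h_poly k q m e:]}"
proof -
  let ?P = "Pi0 k q m" and ?h = "h_poly k q m e"
  have cong: "ideal_cong S [:E:] [:?h:]" if "[:?P:] \<in> ideal_gen S" for S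
    using h_poly_props(2)[OF assms] that by (rule ideal_cong_const)
  show ?thesis
    unfolding ideal_eq_shape
  proof (rule ideal_gen_eqI)
    let ?S = "{[:?P:], yR - [:E:]}" and ?T = "{[:?P:], yR - [:?h:]}"
    have S: "ideal_cong ?S yR [:E:]" and T: "ideal_cong ?T yR [:?h:]"
      by (simp_all add: ideal_cong_def ideal_gen_base)
    have "ideal_cong ?T yR [:E:]"
      by (rule ideal_cong_trans[OF T ideal_cong_sym[OF cong]]) (simp add: ideal_gen_base)
    then show "?S \<subseteq> ideal_gen ?T"
      by (simp add: ideal_cong_def ideal_gen_base)
    have "ideal_cong ?S yR [:?h:]"
      by (rule ideal_cong_trans[OF S cong]) (simp add: ideal_gen_base)
    then show "?T \<subseteq> ideal_gen ?S"
      by (simp add: ideal_cong_def ideal_gen_base)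
  qed
qed

end

theorem theorem4p7:
  fixes k m r q :: nat
  assumes "k \<ge> 1" and "m \<ge> 1" and "r \<ge> 2" and "q = 2 * r - 1" and "gcd m k = 1"
  shows "pretzel_ideal k r m = ideal_gen {[:A_poly q:], G_poly k, H_poly m} \<and>
    D_set k q m = {\<delta>. \<delta> > 1 \<and> \<delta> dvd q \<and> \<delta> dvd m * k \<and> \<not> \<delta> dvd m \<and> \<not> \<delta> dvd k} \<and>
    (D_set k q m = {} \<longrightarrow> AG2 k r m = {1}) \<and>
    (D_set k q m \<noteq> {} \<longrightarrow>
      (\<forall>u v e :: int. u * int m + v * int k = int (gcd m k) \<and> e = u * int m - v * int k \<longrightarrow>
        pretzel_ideal k r m = ideal_gen {[:Pi0 k q m:], yR - [:h_poly k q m e:]} \<and>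
        AG2 k r m = {yR - [:h_poly k q m e:], [:Pi0 k q m:]}))"
proof -
  have q: "odd q"
    using assms(3,4) by simp
  have I: "pretzel_ideal k r m = ideal_gen {[:A_poly q:], G_poly k, H_poly m}"
    using assms by (simp only: assms(4)) (rule pretzel_ideal_eq; simp)
  have E: "\<exists>E. cong_x_powi (A_poly q) E e" for e
    using coprime_X_A_poly[OF q] by (rule cong_x_powi_exists)
  \<comment> \<open>The set $\mathcal{D}$ and the case of the unit ideal do not mention \<open>u\<close> and \<open>v\<close>, so any choice will do.\<close>
  obtain u v :: int where uv: "u * int m + v * int k = 1"
    using bezout_int[of "int m" "int k"] assms(5) by auto
  obtain E where E0: "cong_x_powi (A_poly q) E (u * int m - v * int k)"
    using E by blast
  note context0 = assms(1,2) q uv refl E0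
  have "AG2 k r m = {1}" if "D_set k q m = {}"
  proof -
    have "pretzel_ideal k r m = UNIV"
      unfolding I ideal_eq_shape[OF context0]
      by (intro ideal_gen_one ideal_gen_base) (simp add: Pi0_def that)
    then show ?thesis
      by (simp add: AG2_def reduced_groebner_basis_UNIV)
  qed
  moreover have "pretzel_ideal k r m = ideal_gen {[:Pi0 k q m:], yR - [:h_poly k q m e:]} \<and>
      AG2 k r m = {yR - [:h_poly k q m e:], [:Pi0 k q m:]}"
    if D: "D_set k q m \<noteq> {}" and uv': "u * int m + v * int k = 1" "e = u * int m - v * int k"
    for u v e
  proof -
    obtain E where E1: "cong_x_powi (A_poly q) E e"
      using E by blast
    note context1 = assms(1,2) q uv' E1
    have eq: "pretzel_ideal k r m = ideal_gen {[:Pi0 k q m:], yR - [:h_poly k q m e:]}"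
      unfolding I by (rule ideal_eq_shape_h_poly[OF context1 D])
    have "reduced_groebner_basis (pretzel_ideal k r m) =
        (\<lambda>G. G = {yR - [:h_poly k q m e:], [:Pi0 k q m:]})"
      unfolding eq
      by (intro ext reduced_groebner_basis_shape lead_coeff_Pi0[OF context1]
          degree_Pi0_pos[OF context1 D] h_poly_props(1)[OF context1 D])
    then have "AG2 k r m = {yR - [:h_poly k q m e:], [:Pi0 k q m:]}"
      by (simp add: AG2_def)
    with eq show ?thesis ..
  qed
  ultimately show ?thesis
    using I D_set_eq[OF context0] assms(5) by (simp add: split_divisors_def)
qed

end
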